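(* Let $N$ and $v$ be integers with $2\le v\le N$, let $f=\lfloor\frac{N+1}{v}\rfloor$ and $d=(f+1)v-N$, and let \[\Lambda(N,v)=\Big\lfloor\tfrac{1}{d}\sum_{i=f-d+2}^{f}(f+1-i)\tbinom{N}{i}\Big\rfloor+\sum_{i=0}^{f-d+1}\tbinom{N}{i}.\] Then $\mathrm{LAK}_{(\bar1,1)}(N,v)=\Lambda(N,v)$ if $d\ge f+2$ and $\sum_{i=0}^{f}(f+1-i)\binom{N}{i}\equiv x\pmod d$ for some $x\in\{f+1,\dots,d-1\}$; otherwise $\mathrm{LAK}_{(\bar1,1)}(N,v)=\Lambda(N,v)-1$.
   Context: Binomial coefficients with negative lower index are $0$; empty sums are $0$. For an $N\times k$ array $A$ with entries in each column from a $v$-element symbol set, and column $\gamma$, symbol $\sigma$, let $\rho_A(\{(\gamma,\sigma)\})=\{r:A_{r\gamma}=\sigma\}$; for a set $\mathcal T$ of such 1-way interactions, $\rho_A(\mathcal T)=\bigcup_{T\in\mathcal T}\rho_A(T)$, with $\rho_A(\emptyset)=\emptyset$. $A$ is a $(\bar1,1)$-locating array if for all sets $\mathcal T_1,\mathcal T_2$ of 1-way interactions with $|\mathcal T_1|\le1$, $|\mathcal T_2|\le1$, $\rho_A(\mathcal T_1)=\rho_A(\mathcal T_2)\iff\mathcal T_1=\mathcal T_2$. $\mathrm{LAK}_{(\bar1,1)}(N,v)$ is the largest $k$ for which a $(\bar1,1)$-locating array with $N$ rows, $k$ columns and $v$ symbols exists. *)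

theory Defs
  imports Complex_Main "HOL-Number_Theory.Cong"
begin

text \<open>
  Rows are indexed by \<open>{..<N}\<close>, columns by \<open>{..<k}\<close>, and column \<open>\<gamma>\<close> has symbol set \<open>S \<gamma>\<close>.
  Values of \<open>A\<close> outside this index range are irrelevant.
\<close>

definition is_array :: "nat \<Rightarrow> nat \<Rightarrow> nat \<Rightarrow> (nat \<Rightarrow> 's set) \<Rightarrow> (nat \<Rightarrow> nat \<Rightarrow> 's) \<Rightarrow> bool" where
  "is_array N k v S A \<longleftrightarrow>
     (\<forall>\<gamma><k. finite (S \<gamma>) \<and> card (S \<gamma>) = v) \<and> (\<forall>r<N. \<forall>\<gamma><k. A r \<gamma> \<in> S \<gamma>)"

definition one_way_interactions :: "nat \<Rightarrow> (nat \<Rightarrow> 's set) \<Rightarrow> (nat \<times> 's) set set" where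
  "one_way_interactions k S = {{(\<gamma>, \<sigma>)} | \<gamma> \<sigma>. \<gamma> < k \<and> \<sigma> \<in> S \<gamma>}"

definition rho :: "nat \<Rightarrow> (nat \<Rightarrow> nat \<Rightarrow> 's) \<Rightarrow> (nat \<times> 's) set \<Rightarrow> nat set" where
  "rho N A T = {r. r < N \<and> (\<forall>(\<gamma>, \<sigma>) \<in> T. A r \<gamma> = \<sigma>)}"

definition rho_set :: "nat \<Rightarrow> (nat \<Rightarrow> nat \<Rightarrow> 's) \<Rightarrow> (nat \<times> 's) set set \<Rightarrow> nat set" where
  "rho_set N A \<T> = (\<Union>T\<in>\<T>. rho N A T)"

definition is_locating_bar1_1 ::
  "nat \<Rightarrow> nat \<Rightarrow> (nat \<Rightarrow> 's set) \<Rightarrow> (nat \<Rightarrow> nat \<Rightarrow> 's) \<Rightarrow> bool" where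
  "is_locating_bar1_1 N k S A \<longleftrightarrow>
     (\<forall>\<T>1 \<T>2. \<T>1 \<subseteq> one_way_interactions k S \<and> \<T>2 \<subseteq> one_way_interactions k S \<and>
        finite \<T>1 \<and> finite \<T>2 \<and> card \<T>1 \<le> 1 \<and> card \<T>2 \<le> 1 \<longrightarrow>
        (rho_set N A \<T>1 = rho_set N A \<T>2 \<longleftrightarrow> \<T>1 = \<T>2))"

definition locating_sizes :: "nat \<Rightarrow> nat \<Rightarrow> nat set" where
  "locating_sizes N v =
     {k. \<exists>(S :: nat \<Rightarrow> nat set) A. is_array N k v S A \<and> is_locating_bar1_1 N k S A}"

definition LAK_bar1_1 :: "nat \<Rightarrow> nat \<Rightarrow> nat" where
  "LAK_bar1_1 N v = Max (locating_sizes N v)"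

definition binom_int :: "nat \<Rightarrow> int \<Rightarrow> int" where
  "binom_int n i = (if i < 0 then 0 else int (n choose nat i))"

text \<open>The maximum in \<^const>\<open>LAK_bar1_1\<close> is over a nonempty set, finite for \<open>v \<ge> 1\<close>.\<close>

lemma zero_in_locating_sizes: "0 \<in> locating_sizes N v"
  by (auto simp: locating_sizes_def is_array_def is_locating_bar1_1_def one_way_interactions_def)

lemma finite_locating_sizes:
  assumes "1 \<le> v"
  shows "finite (locating_sizes N v)"
proof -
  have "k \<le> 2 ^ N" if "k \<in> locating_sizes N v" for k
  proof -
    from that obtain S :: "nat \<Rightarrow> nat set" and A
      where arr: "is_array N k v S A" and loc: "is_locating_bar1_1 N k S A"
      by (auto simp: locating_sizes_def)
    have "\<exists>\<sigma>. \<sigma> \<in> S \<gamma>" if "\<gamma> < k" for \<gamma>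
      using arr that assms unfolding is_array_def by (metis card.empty ex_in_conv not_one_le_zero)
    then obtain s where s: "\<And>\<gamma>. \<gamma> < k \<Longrightarrow> s \<gamma> \<in> S \<gamma>"
      by metis
    define g where "g \<gamma> = rho_set N A {{(\<gamma>, s \<gamma>)}}" for \<gamma>
    have "inj_on g {..<k}"
    proof (rule inj_onI)
      fix a b assume ab: "a \<in> {..<k}" "b \<in> {..<k}" "g a = g b"
      have "{{(a, s a)}} = {{(b, s b)}}"
        using loc[unfolded is_locating_bar1_1_def, rule_format,
            of "{{(a, s a)}}" "{{(b, s b)}}"] ab s
        by (auto simp: g_def one_way_interactions_def)
      then show "a = b" by simp
    qed
    moreover have "g ` {..<k} \<subseteq> Pow {..<N}"
      by (auto simp: g_def rho_set_def rho_def)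
    ultimately have "card {..<k} \<le> card (Pow {..<N})"
      by (intro card_inj_on_le) auto
    then show ?thesis by (simp add: card_Pow)
  qed
  then show ?thesis
    by (meson finite_nat_set_iff_bounded_le)
qed

end

theory Submission
  imports Defs
begin

text \<open>
  A locating array as in \<^const>\<open>is_locating_bar1_1\<close> is a family of \<open>k\<close> partitions of the rows into \<open>v\<close> nonempty blocks such that
  all blocks are distinct. Give a block \<open>X\<close> the weight \<open>min d (f + 1 - |X|)\<close> (or \<open>0\<close> if \<open>|X| > f\<close>).
  The numbers \<open>f + 1 - |X|\<close> sum to \<open>d\<close> over each partition, so each partition has weight at least \<open>d\<close>
  and \<open>k\<close> is at most the total weight of all nonempty sets divided by \<open>d\<close>.

  Conversely, by a Baranyai type theorem it suffices to prescribe the block sizes: if the columns use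
  at most \<open>N choose i\<close> blocks of size \<open>i\<close> for every \<open>i\<close>, then they can be realised. Columns of weight
  exactly \<open>d\<close> that use up the total weight, except for a remainder below \<open>d\<close>, are obtained by packing weights into bins of
  capacity \<open>d\<close>; this works because the number of sets of weight \<open>w\<close> is at least \<open>v - 1\<close> times the
  number of sets of weight \<open>w + 1\<close>.
\<close>

section \<open>Rounding of bipartite weights\<close>

text \<open>Gaussian elimination: a pivot \<open>e0\<close> of equation \<open>t\<close> removes one
  unknown and one equation, so the surplus of unknowns survives the induction.\<close>

lemma underdetermined_system_nontrivial_solution:
  fixes c :: "'t \<Rightarrow> 'e \<Rightarrow> real"
  assumes "finite T" "finite F" "card T < card F"
  shows "\<exists>x. (\<exists>e\<in>F. x e \<noteq> 0) \<and> (\<forall>e. e \<notin> F \<longrightarrow> x e = 0) \<and> (\<forall>t\<in>T. (\<Sum>e\<in>F. c t e * x e) = 0)"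
  using assms
proof (induction T arbitrary: F c rule: finite_induct)
  case empty
  then have "F \<noteq> {}" by auto
  then show ?case
    by (intro exI[of _ "\<lambda>e. if e \<in> F then 1 else 0"]) auto
next
  case (insert t T)
  show ?case
  proof (cases "\<forall>e\<in>F. c t e = 0")
    case True
    have "card T < card F" using insert by simp
    with insert.IH[OF insert.prems(1)] obtain x where
      "\<exists>e\<in>F. x e \<noteq> 0" "\<forall>e. e \<notin> F \<longrightarrow> x e = 0" "\<forall>s\<in>T. (\<Sum>e\<in>F. c s e * x e) = 0"
      by blast
    with True show ?thesis by (intro exI[of _ x]) auto
  next
    case False
    then obtain e0 where e0: "e0 \<in> F" "c t e0 \<noteq> 0" by blast
    define F' where "F' = F - {e0}"
    define c' where "c' s e = c s e - c s e0 * c t e / c t e0" for s e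
    have "card T < card F'" "finite F'" using insert e0 by (auto simp: F'_def)
    with insert.IH[of F' c'] obtain x where
      x: "\<exists>e\<in>F'. x e \<noteq> 0" "\<And>e. e \<notin> F' \<Longrightarrow> x e = 0" "\<And>s. s \<in> T \<Longrightarrow> (\<Sum>e\<in>F'. c' s e * x e) = 0"
      by blast
    define y where "y = x(e0 := - (\<Sum>e\<in>F'. c t e * x e) / c t e0)"
    have split: "(\<Sum>e\<in>F. c s e * y e) = c s e0 * y e0 + (\<Sum>e\<in>F'. c s e * x e)" for s
    proof -
      have "(\<Sum>e\<in>F. c s e * y e) = c s e0 * y e0 + (\<Sum>e\<in>F'. c s e * y e)"
        unfolding F'_def using insert.prems(1) e0(1) by (simp add: sum.remove)
      also have "(\<Sum>e\<in>F'. c s e * y e) = (\<Sum>e\<in>F'. c s e * x e)"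
        by (intro sum.cong) (auto simp: y_def F'_def)
      finally show ?thesis .
    qed
    have "(\<Sum>e\<in>F. c t e * y e) = 0" unfolding split using e0 by (simp add: y_def)
    moreover have "(\<Sum>e\<in>F. c s e * y e) = 0" if "s \<in> T" for s
    proof -
      have "0 = (\<Sum>e\<in>F'. c' s e * x e)" using x(3)[OF that] by simp
      also have "\<dots> = (\<Sum>e\<in>F'. c s e * x e) - (\<Sum>e\<in>F'. (c s e0 / c t e0) * (c t e * x e))"
        unfolding sum_subtractf[symmetric] c'_def by (intro sum.cong) (auto simp: algebra_simps)
      also have "\<dots> = (\<Sum>e\<in>F. c s e * y e)"
        unfolding split by (simp add: y_def sum_distrib_left sum_divide_distrib)
      finally show ?thesis by simp
    qed
    moreover have "\<exists>e\<in>F. y e \<noteq> 0" using x(1) by (auto simp: y_def F'_def)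
    moreover have "\<forall>e. e \<notin> F \<longrightarrow> y e = 0" using x(2) e0(1) by (auto simp: y_def F'_def)
    ultimately show ?thesis by (intro exI[of _ y]) auto
  qed
qed

lemma two_le_card_fractional_of_integral_sum:
  fixes w :: "'e \<Rightarrow> real"
  assumes "finite U" "sum w U \<in> \<int>" "e \<in> U" "w e \<notin> \<int>"
  shows "2 \<le> card {e \<in> U. w e \<notin> \<int>}"
proof (rule ccontr)
  assume a: "\<not> ?thesis"
  have "0 < card {e \<in> U. w e \<notin> \<int>}" using assms by (auto simp: card_gt_0_iff)
  with a have "card {e \<in> U. w e \<notin> \<int>} = 1" by simp
  then obtain e' where "{e \<in> U. w e \<notin> \<int>} = {e'}" by (auto simp: card_1_singleton_iff)
  with assms have eq: "{e \<in> U. w e \<notin> \<int>} = {e}" by auto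
  have "sum w (U - {e}) \<in> \<int>" using eq by (intro Ints_sum) auto
  moreover have "sum w U = w e + sum w (U - {e})" using assms by (simp add: sum.remove)
  ultimately have "w e \<in> \<int>" using assms(2) by (metis Ints_diff add_diff_cancel_right')
  with assms show False by simp
qed

text \<open>A fractional entry is never alone in a fibre with integral sum. Fibres are disjoint, so
  \<open>V\<close>, the set of fractional entries in such fibres, has at least
  \<open>2 * card T\<close> elements; equality leaves no fractional entry outside
  \<open>V\<close>.\<close>

lemma card_integral_fibres:
  fixes w :: "'e \<Rightarrow> real" and p :: "'e \<Rightarrow> 'a"
  assumes "finite E"
  defines "F \<equiv> {e \<in> E. w e \<notin> \<int>}"
  defines "T \<equiv> {a \<in> p ` F. sum w {e \<in> E. p e = a} \<in> \<int>}"
  shows "2 * card T \<le> card F" "2 * card T = card F \<Longrightarrow> p ` F \<subseteq> T"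
proof -
  have fin: "finite F" "finite T" using assms by auto
  define V where "V = {e \<in> F. p e \<in> T}"
  have "2 \<le> card {e \<in> V. p e = a}" if "a \<in> T" for a
  proof -
    from that obtain e where e: "e \<in> F" "p e = a" by (auto simp: T_def)
    have "2 \<le> card {e' \<in> {e \<in> E. p e = a}. w e' \<notin> \<int>}"
      using that e assms by (intro two_le_card_fractional_of_integral_sum[of _ _ e]) auto
    also have "{e' \<in> {e \<in> E. p e = a}. w e' \<notin> \<int>} = {e \<in> V. p e = a}"
      using that by (auto simp: V_def F_def)
    finally show ?thesis .
  qed
  then have "(\<Sum>a\<in>T. 2) \<le> (\<Sum>a\<in>T. card {e \<in> V. p e = a})" by (intro sum_mono) auto
  also have "\<dots> = card V"
    using fin by (subst card_eq_sum, subst sum.group[of V T p "\<lambda>_. 1", symmetric]) (auto simp: V_def)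
  finally have V: "2 * card T \<le> card V" by simp
  have "V \<subseteq> F" by (auto simp: V_def)
  with V fin show "2 * card T \<le> card F" using card_mono by (meson le_trans)
  assume "2 * card T = card F"
  with V \<open>V \<subseteq> F\<close> fin have "V = F" by (metis card_seteq)
  then show "p ` F \<subseteq> T" by (auto simp: V_def)
qed

text \<open>Two fractional entries are needed in every fibre whose sum is integral, so there are at most as
  many integral fibres as fractional entries; in the case of equality the two families of fibre
  equations are dependent, since both sum to the total.\<close>

lemma ex_fractional_direction:
  fixes w :: "'e \<Rightarrow> real" and p :: "'e \<Rightarrow> 'a" and q :: "'e \<Rightarrow> 'b"
  assumes E: "finite E" and frac: "\<exists>e\<in>E. w e \<notin> \<int>"
  shows "\<exists>x. (\<exists>e\<in>E. w e \<notin> \<int> \<and> x e \<noteq> 0) \<and> (\<forall>e\<in>E. w e \<in> \<int> \<longrightarrow> x e = 0) \<and>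
    (\<forall>a. sum w {e \<in> E. p e = a} \<in> \<int> \<longrightarrow> sum x {e \<in> E. p e = a} = (0::real)) \<and>
    (\<forall>b. sum w {e \<in> E. q e = b} \<in> \<int> \<longrightarrow> sum x {e \<in> E. q e = b} = 0)"
proof -
  define F where "F = {e \<in> E. w e \<notin> \<int>}"
  define P where "P = {a \<in> p ` F. sum w {e \<in> E. p e = a} \<in> \<int>}"
  define Q where "Q = {a \<in> q ` F. sum w {e \<in> E. q e = a} \<in> \<int>}"
  have fin: "finite F" "finite P" "finite Q" using E by (auto simp: F_def P_def Q_def)
  have F0: "F \<noteq> {}" using frac by (auto simp: F_def)
  have cP: "2 * card P \<le> card F" "2 * card P = card F \<Longrightarrow> p ` F \<subseteq> P"
    using card_integral_fibres[OF E, where w = w and p = p] by (auto simp: F_def P_def)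
  have cQ: "2 * card Q \<le> card F" "2 * card Q = card F \<Longrightarrow> q ` F \<subseteq> Q"
    using card_integral_fibres[OF E, where w = w and p = q] by (auto simp: F_def Q_def)
  define c :: "'a + 'b \<Rightarrow> 'e \<Rightarrow> real" where
    "c t e = (case t of Inl a \<Rightarrow> of_bool (p e = a) | Inr b \<Rightarrow> of_bool (q e = b))" for t e
  have sumF: "sum x {e \<in> E. R e} = (\<Sum>e\<in>F. of_bool (R e) * x e)"
    if "\<And>e. e \<notin> F \<Longrightarrow> x e = 0" for x :: "'e \<Rightarrow> real" and R
  proof -
    have "(\<Sum>e\<in>F. of_bool (R e) * x e) = (\<Sum>e\<in>E. if R e then x e else 0)"
      using that E by (intro sum.mono_neutral_cong_left) (auto simp: F_def)
    then show ?thesis using E by (simp add: sum.inter_filter)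
  qed
  have "\<exists>x. (\<exists>e\<in>F. x e \<noteq> 0) \<and> (\<forall>e. e \<notin> F \<longrightarrow> x e = 0) \<and> (\<forall>t\<in>P <+> Q. (\<Sum>e\<in>F. c t e * x e) = 0)"
  proof (cases "card P + card Q < card F")
    case True
    then show ?thesis
      using fin by (intro underdetermined_system_nontrivial_solution) (auto simp: card_Plus)
  next
    case False
    with cP cQ have sub: "p ` F \<subseteq> P" "q ` F \<subseteq> Q" by auto
    \<comment> \<open>Every fractional entry now lies in an integral fibre of \<open>p\<close> and
      in one of \<open>q\<close>. The equation of \<open>b0\<close> is omitted and recovered from
      \<open>sum x F = 0\<close>.\<close>
    from F0 sub obtain b0 where b0: "b0 \<in> Q" by auto
    have "card (P <+> (Q - {b0})) < card F"
    proof -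
      have "card Q > 0" using b0 fin by (auto simp: card_gt_0_iff)
      then show ?thesis using cP(1) cQ(1) fin b0 by (simp add: card_Plus card_Diff_singleton)
    qed
    then obtain x where x: "\<exists>e\<in>F. x e \<noteq> 0" "\<And>e. e \<notin> F \<Longrightarrow> x e = 0"
      "\<And>t. t \<in> P <+> (Q - {b0}) \<Longrightarrow> (\<Sum>e\<in>F. c t e * x e) = 0"
      using underdetermined_system_nontrivial_solution[of "P <+> (Q - {b0})" F c] fin by auto
    have "(\<Sum>a\<in>P. \<Sum>e\<in>F. c (Inl a) e * x e) = (\<Sum>e\<in>F. \<Sum>a\<in>P. c (Inl a) e * x e)"
      by (rule sum.swap)
    also have "\<dots> = sum x F"
      using sub fin by (intro sum.cong) (auto simp: c_def of_bool_def if_distrib[of "\<lambda>z. z * _"] cong: if_cong)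
    finally have "sum x F = (\<Sum>a\<in>P. \<Sum>e\<in>F. c (Inl a) e * x e)" by simp
    also have "\<dots> = 0" using x(3) by (intro sum.neutral) auto
    finally have 1: "sum x F = 0" .
    have "(\<Sum>a\<in>Q. \<Sum>e\<in>F. c (Inr a) e * x e) = (\<Sum>e\<in>F. \<Sum>a\<in>Q. c (Inr a) e * x e)"
      by (rule sum.swap)
    also have "\<dots> = sum x F"
      using sub fin by (intro sum.cong) (auto simp: c_def of_bool_def if_distrib[of "\<lambda>z. z * _"] cong: if_cong)
    finally have "(\<Sum>a\<in>Q. \<Sum>e\<in>F. c (Inr a) e * x e) = 0" using 1 by simp
    moreover have "(\<Sum>a\<in>Q. \<Sum>e\<in>F. c (Inr a) e * x e) = (\<Sum>e\<in>F. c (Inr b0) e * x e) + (\<Sum>a\<in>Q-{b0}. \<Sum>e\<in>F. c (Inr a) e * x e)"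
      using fin b0 by (simp add: sum.remove)
    moreover have "(\<Sum>a\<in>Q-{b0}. \<Sum>e\<in>F. c (Inr a) e * x e) = 0" using x(3) by (intro sum.neutral) auto
    ultimately have "(\<Sum>e\<in>F. c (Inr b0) e * x e) = 0" by simp
    with x show ?thesis by (intro exI[of _ x]) (auto simp: Plus_def)
  qed
  then obtain x where x: "\<exists>e\<in>F. x e \<noteq> 0" "\<And>e. e \<notin> F \<Longrightarrow> x e = 0"
    "\<And>t. t \<in> P <+> Q \<Longrightarrow> (\<Sum>e\<in>F. c t e * x e) = 0" by blast
  have "sum x {e \<in> E. p e = a} = 0" if "sum w {e \<in> E. p e = a} \<in> \<int>" for a
  proof (cases "a \<in> P")
    case True
    then show ?thesis using x(3)[of "Inl a"] sumF[OF x(2), where R = "\<lambda>e. p e = a"] by (auto simp: c_def)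
  next
    case False
    then have "a \<notin> p ` F" using that by (auto simp: P_def)
    then show ?thesis by (intro sum.neutral ballI x(2)) auto
  qed
  moreover have "sum x {e \<in> E. q e = a} = 0" if "sum w {e \<in> E. q e = a} \<in> \<int>" for a
  proof (cases "a \<in> Q")
    case True
    then show ?thesis using x(3)[of "Inr a"] sumF[OF x(2), where R = "\<lambda>e. q e = a"] by (auto simp: c_def)
  next
    case False
    then have "a \<notin> q ` F" using that by (auto simp: Q_def)
    then show ?thesis by (intro sum.neutral ballI x(2)) auto
  qed
  ultimately show ?thesis using x(1,2) by (intro exI[of _ x]) (auto simp: F_def)
qed

text \<open>Start at \<open>a\<close> and move along \<open>b\<close>. A moving coordinate begins
  strictly between its floor and ceiling, \<open>\<tau> i\<close> is the time at which it reaches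
  the one ahead of it, and \<open>t\<close> is the earliest of these times.\<close>

lemma ex_first_integral_time:
  fixes a b :: "'i \<Rightarrow> real"
  assumes "finite I" "\<exists>i\<in>I. b i \<noteq> 0" "\<And>i. i \<in> I \<Longrightarrow> b i \<noteq> 0 \<Longrightarrow> a i \<notin> \<int>"
  shows "\<exists>t. (\<forall>i\<in>I. of_int \<lfloor>a i\<rfloor> \<le> a i + t * b i \<and> a i + t * b i \<le> of_int \<lceil>a i\<rceil>) \<and>
             (\<exists>i\<in>I. a i \<notin> \<int> \<and> a i + t * b i \<in> \<int>)"
proof -
  define J where "J = {i \<in> I. b i \<noteq> 0}"
  define \<tau> where "\<tau> i = (if b i > 0 then (of_int \<lceil>a i\<rceil> - a i) / b i else (of_int \<lfloor>a i\<rfloor> - a i) / b i)" for i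
  have J: "finite J" "J \<noteq> {}" using assms by (auto simp: J_def)
  define t where "t = Min (\<tau> ` J)"
  have "t \<in> \<tau> ` J" unfolding t_def using J by (intro Min_in) auto
  then obtain j where j: "j \<in> J" "t = \<tau> j" by auto
  have nonneg: "0 \<le> \<tau> i" if "i \<in> J" for i
    using that by (auto simp: J_def \<tau>_def intro!: divide_nonneg_pos divide_nonpos_neg)
  have "a j + t * b j \<in> \<int>" using j by (auto simp: J_def \<tau>_def)
  moreover have "of_int \<lfloor>a i\<rfloor> \<le> a i + t * b i \<and> a i + t * b i \<le> of_int \<lceil>a i\<rceil>" if "i \<in> I" for i
  proof (cases "b i = 0")
    case False
    then have i: "i \<in> J" using that by (simp add: J_def)
    then have le: "t \<le> \<tau> i" unfolding t_def using J by auto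
    have t0: "0 \<le> t" using j nonneg by simp
    show ?thesis
    proof (cases "b i > 0")
      case True
      then have "t * b i \<le> of_int \<lceil>a i\<rceil> - a i" using le by (simp add: \<tau>_def pos_le_divide_eq)
      moreover have "0 \<le> t * b i" using t0 True by simp
      ultimately show ?thesis by linarith
    next
      case 2: False
      with False have neg: "b i < 0" by simp
      then have "t * b i \<ge> of_int \<lfloor>a i\<rfloor> - a i" using le by (simp add: \<tau>_def neg_le_divide_eq)
      moreover have "t * b i \<le> 0" using t0 neg by (simp add: mult_nonneg_nonpos)
      ultimately show ?thesis by linarith
    qed
  qed simp
  ultimately show ?thesis using j(1) assms(3)[of j] by (auto simp: J_def)
qed

text \<open>Moving along a direction from \<open>ex_fractional_direction\<close> keeps integral sums
  fixed and stops once a further sum becomes integral. No sum has left the interval between its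
  floor and ceiling, so the bounds for \<open>w'\<close> imply those for \<open>w\<close>, and fewer
  sums over \<open>\<I>\<close> are fractional.\<close>

theorem bipartite_rounding:
  fixes w :: "'e \<Rightarrow> real" and p :: "'e \<Rightarrow> 'a" and q :: "'e \<Rightarrow> 'b"
  assumes "finite E"
  defines "\<I> \<equiv> (\<lambda>e. {e}) ` E \<union> (\<lambda>a. {e \<in> E. p e = a}) ` p ` E \<union> (\<lambda>b. {e \<in> E. q e = b}) ` q ` E"
  shows "\<exists>x :: 'e \<Rightarrow> int. \<forall>U\<in>\<I>. \<lfloor>sum w U\<rfloor> \<le> sum x U \<and> sum x U \<le> \<lceil>sum w U\<rceil>"
proof (induction "card {U \<in> \<I>. sum w U \<notin> \<int>}" arbitrary: w rule: less_induct)
  case less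
  have finI: "finite \<I>" using assms by auto
  show ?case
  proof (cases "\<exists>e\<in>E. w e \<notin> \<int>")
    case False
    define x where "x e = \<lfloor>w e\<rfloor>" for e
    have "of_int (sum x U) = sum w U" if "U \<in> \<I>" for U
    proof -
      have "U \<subseteq> E" using that by (auto simp: \<I>_def)
      then have "(\<Sum>e\<in>U. of_int (x e)) = sum w U"
        using False by (intro sum.cong) (auto simp: x_def Ints_def)
      then show ?thesis by simp
    qed
    then show ?thesis by (intro exI[of _ x] ballI) (metis ceiling_of_int floor_of_int order_refl)
  next
    case True
    obtain y :: "'e \<Rightarrow> real" where y: "\<exists>e\<in>E. w e \<notin> \<int> \<and> y e \<noteq> 0" "\<And>e. e \<in> E \<Longrightarrow> w e \<in> \<int> \<Longrightarrow> y e = 0"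
      "\<And>a. sum w {e \<in> E. p e = a} \<in> \<int> \<Longrightarrow> sum y {e \<in> E. p e = a} = 0"
      "\<And>b. sum w {e \<in> E. q e = b} \<in> \<int> \<Longrightarrow> sum y {e \<in> E. q e = b} = 0"
      using ex_fractional_direction[OF assms(1) True, of p q] by blast
    have tight: "sum y U = 0" if "U \<in> \<I>" "sum w U \<in> \<int>" for U
      using that y(2-4) unfolding \<I>_def by auto
    from y(1) obtain e where "e \<in> E" "y e \<noteq> 0" by blast
    then have "\<exists>U\<in>\<I>. sum y U \<noteq> 0" by (intro bexI[of _ "{e}"]) (auto simp: \<I>_def)
    then obtain t where t: "\<And>U. U \<in> \<I> \<Longrightarrow> of_int \<lfloor>sum w U\<rfloor> \<le> sum w U + t * sum y U \<and>
        sum w U + t * sum y U \<le> of_int \<lceil>sum w U\<rceil>"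
      "\<exists>U\<in>\<I>. sum w U \<notin> \<int> \<and> sum w U + t * sum y U \<in> \<int>"
      using ex_first_integral_time[OF finI, of "sum y" "sum w"] tight by blast
    define w' where "w' e = w e + t * y e" for e
    have w': "sum w' U = sum w U + t * sum y U" for U
      by (simp add: w'_def sum.distrib sum_distrib_left)
    have "{U \<in> \<I>. sum w' U \<notin> \<int>} \<subset> {U \<in> \<I>. sum w U \<notin> \<int>}"
      using t(2) tight by (auto simp: w')
    then have "card {U \<in> \<I>. sum w' U \<notin> \<int>} < card {U \<in> \<I>. sum w U \<notin> \<int>}"
      using finI by (intro psubset_card_mono) auto
    from less[OF this] obtain x :: "'e \<Rightarrow> int" where
      x: "\<And>U. U \<in> \<I> \<Longrightarrow> \<lfloor>sum w' U\<rfloor> \<le> sum x U \<and> sum x U \<le> \<lceil>sum w' U\<rceil>" by blast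
    have "\<lfloor>sum w U\<rfloor> \<le> sum x U \<and> sum x U \<le> \<lceil>sum w U\<rceil>" if "U \<in> \<I>" for U
      using x[OF that] t(1)[OF that] unfolding w' by linarith
    then show ?thesis by blast
  qed
qed

section \<open>A Baranyai type theorem\<close>

text \<open>Only the first \<open>l\<close> rows count, so arrays built row by row have blocks at
  every stage; \<open>l = N\<close> gives the row set of a single interaction.\<close>

definition block :: "nat \<Rightarrow> (nat \<Rightarrow> nat \<Rightarrow> 's) \<Rightarrow> nat \<times> 's \<Rightarrow> nat set" where
  "block l A e = {r. r < l \<and> A r (fst e) = snd e}"

lemma finite_block [simp]: "finite (block l A e)"
  by (simp add: block_def)

lemma sum_card_block:
  assumes "finite V" "\<And>r. r < l \<Longrightarrow> A r \<gamma> \<in> V"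
  shows "(\<Sum>\<sigma>\<in>V. card (block l A (\<gamma>, \<sigma>))) = l"
proof -
  have "(\<Sum>\<sigma>\<in>V. card (block l A (\<gamma>, \<sigma>))) = (\<Sum>\<sigma>\<in>V. sum (\<lambda>_. 1) {r \<in> {..<l}. A r \<gamma> = \<sigma>})"
    by (intro sum.cong) (auto simp: block_def)
  also have "\<dots> = (\<Sum>r<l. 1)"
    using assms by (intro sum.group) auto
  finally show ?thesis by simp
qed

lemma block_Suc:
  "block (Suc l) (A(l := g)) e = block l A e \<union> (if g (fst e) = snd e then {l} else {})"
  by (auto simp: block_def less_Suc_eq)

text \<open>The next row is assigned fractionally: a block still lacking \<open>j\<close> of its elements receives the
  row with weight \<open>j / (N - l)\<close>. The binomial identities say that this respects the capacities, and
  rounding makes it integral.\<close>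

theorem baranyai_extension:
  fixes h :: "nat \<times> nat \<Rightarrow> nat" and N k v :: nat
  defines "E \<equiv> {..<k} \<times> {..<v}"
  assumes colsum: "\<And>\<gamma>. \<gamma> < k \<Longrightarrow> (\<Sum>\<sigma><v. h (\<gamma>, \<sigma>)) = N"
    and cap: "\<And>i. card {e \<in> E. h e = i} \<le> N choose i"
    and "l \<le> N"
  shows "\<exists>A :: nat \<Rightarrow> nat \<Rightarrow> nat. (\<forall>r<l. \<forall>\<gamma><k. A r \<gamma> < v) \<and> (\<forall>e\<in>E. card (block l A e) \<le> h e) \<and>
    (\<forall>X i. card {e \<in> E. h e = i \<and> block l A e = X} \<le> (N - l) choose (i - card X))"
  using \<open>l \<le> N\<close>
proof (induction l)
  case 0
  have "card {e \<in> E. h e = i \<and> X = {}} \<le> N choose (i - card X)" for X :: "nat set" and i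
    using cap by (cases "X = {}") auto
  then show ?case by (auto simp: block_def eq_commute)
next
  case (Suc l)
  have finE: "finite E" by (simp add: E_def)
  from Suc obtain A :: "nat \<Rightarrow> nat \<Rightarrow> nat" where
    A: "\<And>r \<gamma>. r < l \<Longrightarrow> \<gamma> < k \<Longrightarrow> A r \<gamma> < v" "\<And>e. e \<in> E \<Longrightarrow> card (block l A e) \<le> h e"
    and cnt: "\<And>X i. card {e \<in> E. h e = i \<and> block l A e = X} \<le> (N - l) choose (i - card X)"
    by auto
  define n where "n = N - l"
  have n: "n > 0" "N - Suc l = n - 1" using Suc.prems by (auto simp: n_def)
  define S where "S = block l A"
  define w :: "nat \<times> nat \<Rightarrow> real" where "w e = real (h e - card (S e)) / real n" for e
  \<comment> \<open>The rounding respects two partitions of \<open>E\<close>: by column, and by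
    prescribed size together with the block built so far.\<close>
  define q where "q e = (h e, S e)" for e
  have "\<exists>x :: nat \<times> nat \<Rightarrow> int. (\<forall>e\<in>E. \<lfloor>w e\<rfloor> \<le> x e \<and> x e \<le> \<lceil>w e\<rceil>) \<and>
    (\<forall>a\<in>fst ` E. \<lfloor>sum w {e \<in> E. fst e = a}\<rfloor> \<le> sum x {e \<in> E. fst e = a} \<and>
        sum x {e \<in> E. fst e = a} \<le> \<lceil>sum w {e \<in> E. fst e = a}\<rceil>) \<and>
    (\<forall>b\<in>q ` E. \<lfloor>sum w {e \<in> E. q e = b}\<rfloor> \<le> sum x {e \<in> E. q e = b} \<and>
        sum x {e \<in> E. q e = b} \<le> \<lceil>sum w {e \<in> E. q e = b}\<rceil>)"
    using bipartite_rounding[OF finE, of fst q w] by (simp add: ball_Un)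
  then obtain x :: "nat \<times> nat \<Rightarrow> int" where X:
    "\<forall>e\<in>E. \<lfloor>w e\<rfloor> \<le> x e \<and> x e \<le> \<lceil>w e\<rceil>"
    "\<forall>a\<in>fst ` E. \<lfloor>sum w {e \<in> E. fst e = a}\<rfloor> \<le> sum x {e \<in> E. fst e = a} \<and>
        sum x {e \<in> E. fst e = a} \<le> \<lceil>sum w {e \<in> E. fst e = a}\<rceil>"
    "\<forall>b\<in>q ` E. \<lfloor>sum w {e \<in> E. q e = b}\<rfloor> \<le> sum x {e \<in> E. q e = b} \<and>
        sum x {e \<in> E. q e = b} \<le> \<lceil>sum w {e \<in> E. q e = b}\<rceil>"
    by (elim exE conjE) (rule that)
  note x = X[rule_format]
  \<comment> \<open>The sizes still missing in a column add up to the \<open>n\<close> remaining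
    rows. Column sum 1 later makes the rounding choose exactly one symbol for row
    \<open>l\<close>.\<close>
  have wsum: "(\<Sum>\<sigma><v. w (\<gamma>, \<sigma>)) = 1" if "\<gamma> < k" for \<gamma>
  proof -
    have "(\<Sum>\<sigma><v. h (\<gamma>, \<sigma>) - card (S (\<gamma>, \<sigma>))) = (\<Sum>\<sigma><v. h (\<gamma>, \<sigma>)) - (\<Sum>\<sigma><v. card (S (\<gamma>, \<sigma>)))"
      using A(2) that by (intro sum_subtractf_nat) (auto simp: S_def E_def)
    also have "\<dots> = n" using colsum[OF that] sum_card_block[of "{..<v}" l A \<gamma>] A(1) that
      by (simp add: n_def S_def)
    finally have "real (\<Sum>\<sigma><v. h (\<gamma>, \<sigma>) - card (S (\<gamma>, \<sigma>))) = real n" by simp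
    then show ?thesis using n by (simp add: w_def sum_divide_distrib[symmetric])
  qed
  have w0: "w e \<ge> 0" for e by (simp add: w_def)
  have w1: "w e \<le> 1" if eE: "e \<in> E" for e
  proof -
    obtain \<gamma> \<sigma> where e: "e = (\<gamma>, \<sigma>)" "\<gamma> < k" "\<sigma> < v" using eE by (auto simp: E_def)
    have "w (\<gamma>, \<sigma>) \<le> (\<Sum>\<sigma><v. w (\<gamma>, \<sigma>))"
      using w0 e by (intro member_le_sum) auto
    then show ?thesis using wsum e by simp
  qed
  have x01: "x e \<in> {0, 1}" if "e \<in> E" for e
  proof -
    have "0 \<le> \<lfloor>w e\<rfloor>" "\<lceil>w e\<rceil> \<le> 1" using w0[of e] w1[OF that] by (auto simp: ceiling_le_iff)
    then have "x e = 0 \<or> x e = 1" using x(1)[OF that] by linarith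
    then show ?thesis by simp
  qed
  have fibre: "{e \<in> E. fst e = \<gamma>} = (\<lambda>\<sigma>. (\<gamma>, \<sigma>)) ` {..<v}" if "\<gamma> < k" for \<gamma>
    using that by (auto simp: E_def)
  have sumfib: "sum u {e \<in> E. fst e = \<gamma>} = (\<Sum>\<sigma><v. u (\<gamma>, \<sigma>))" if "\<gamma> < k"
    for \<gamma> and u :: "nat \<times> nat \<Rightarrow> 'c::comm_monoid_add"
    unfolding fibre[OF that] by (subst sum.reindex) (auto simp: inj_on_def)
  have xsum: "(\<Sum>\<sigma><v. x (\<gamma>, \<sigma>)) = 1" if "\<gamma> < k" for \<gamma>
  proof -
    have "\<exists>\<sigma>. \<sigma> < v" using wsum[OF that] by (cases v) auto
    then have "\<gamma> \<in> fst ` E" using that by (force simp: E_def)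
    from x(2)[OF this] show ?thesis unfolding sumfib[OF that] wsum[OF that] by simp
  qed
  have "\<exists>\<sigma><v. \<forall>\<tau><v. x (\<gamma>, \<tau>) = (if \<tau> = \<sigma> then 1 else 0)" if \<gamma>: "\<gamma> < k" for \<gamma>
  proof -
    from xsum[OF that] have "\<exists>\<sigma>\<in>{..<v}. x (\<gamma>, \<sigma>) \<noteq> 0" by (metis sum.neutral zero_neq_one)
    then obtain \<sigma> where s: "\<sigma> < v" "x (\<gamma>, \<sigma>) = 1" using x01 \<gamma> by (fastforce simp: E_def)
    have "(\<Sum>\<tau>\<in>{..<v}. x (\<gamma>, \<tau>)) = x (\<gamma>, \<sigma>) + (\<Sum>\<tau>\<in>{..<v} - {\<sigma>}. x (\<gamma>, \<tau>))"
      using s by (intro sum.remove) auto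
    then have "(\<Sum>\<tau>\<in>{..<v} - {\<sigma>}. x (\<gamma>, \<tau>)) = 0" using xsum[OF that] s by simp
    moreover have "\<forall>\<tau>\<in>{..<v} - {\<sigma>}. 0 \<le> x (\<gamma>, \<tau>)" using x01 that by (force simp: E_def)
    ultimately have "\<forall>\<tau>\<in>{..<v} - {\<sigma>}. x (\<gamma>, \<tau>) = 0"
      by (subst (asm) sum_nonneg_eq_0_iff) auto
    with s show ?thesis by (intro exI[of _ \<sigma>]) auto
  qed
  then obtain g where g: "\<And>\<gamma>. \<gamma> < k \<Longrightarrow> g \<gamma> < v"
      "\<And>\<gamma> \<tau>. \<gamma> < k \<Longrightarrow> \<tau> < v \<Longrightarrow> x (\<gamma>, \<tau>) = (if \<tau> = g \<gamma> then 1 else 0)"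
    by metis
  have xg: "x e = of_bool (g (fst e) = snd e)" if "e \<in> E" for e
    using that g(2)[of "fst e" "snd e"] by (auto simp: E_def)
  define A' where "A' = A(l := g)"
  have S': "block (Suc l) A' e = S e \<union> (if g (fst e) = snd e then {l} else {})" for e
    by (simp add: A'_def S_def block_Suc)
  have lS: "l \<notin> S e" "finite (S e)" for e by (auto simp: S_def block_def)
  have small: "card (block (Suc l) A' e) \<le> h e" if "e \<in> E" for e
  proof (cases "card (S e) < h e")
    case True
    then show ?thesis using lS[of e] by (auto simp: S')
  next
    \<comment> \<open>A complete block has weight 0, which rounding cannot change, so it does not
      receive the row.\<close>
    case False
    then have "w e = 0" by (simp add: w_def)
    then have "x e = 0" using x(1)[OF that] by simp
    then show ?thesis using A(2)[OF that] xg[OF that] lS[of e] by (auto simp: S' S_def)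
  qed
  define C where "C i X = {e \<in> E. h e = i \<and> S e = X}" for i X
  have finC: "finite (C i X)" for i X using finE by (simp add: C_def)
  have chosen: "int (card {e \<in> C i X. g (fst e) = snd e}) = sum x (C i X)" for i X
  proof -
    have "sum x (C i X) = (\<Sum>e\<in>C i X. of_bool (g (fst e) = snd e))"
      by (intro sum.cong) (auto simp: C_def xg)
    also have "\<dots> = int (card {e \<in> C i X. g (fst e) = snd e})"
      using finC[of i X] by (simp add: Int_def conj_commute)
    finally show ?thesis by simp
  qed
  have wC: "sum w (C i X) = real (card (C i X)) * real (i - card X) / real n" for i X
  proof -
    have "sum w (C i X) = (\<Sum>e\<in>C i X. real (i - card X) / real n)"
      by (intro sum.cong) (auto simp: C_def w_def)
    then show ?thesis by simp
  qed
  have xC: "\<lfloor>sum w (C i X)\<rfloor> \<le> sum x (C i X)" "sum x (C i X) \<le> \<lceil>sum w (C i X)\<rceil>" for i X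
  proof -
    have "\<lfloor>sum w (C i X)\<rfloor> \<le> sum x (C i X) \<and> sum x (C i X) \<le> \<lceil>sum w (C i X)\<rceil>"
    proof (cases "(i, X) \<in> q ` E")
      case True
      from x(3)[OF this] show ?thesis by (simp add: C_def q_def)
    next
      case False
      then have "C i X = {}" by (auto simp: C_def q_def)
      then show ?thesis by simp
    qed
    then show "\<lfloor>sum w (C i X)\<rfloor> \<le> sum x (C i X)" "sum x (C i X) \<le> \<lceil>sum w (C i X)\<rceil>" by auto
  qed
  have cardC: "card (C i X) \<le> n choose (i - card X)" for i X
    using cnt[of i X] by (simp add: C_def S_def n_def)
  \<comment> \<open>With \<open>j = i - card X\<close>, the identity
    \<open>j * (n choose j) = n * ((n - 1) choose (j - 1))\<close> bounds the total weight of the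
    class by an integer, which then bounds the ceiling too. This is the capacity for the blocks
    enlarged by \<open>l\<close>.\<close>
  have up: "card {e \<in> C i X. g (fst e) = snd e} \<le> (n - 1) choose (i - card X - 1)" if "card X < i" for i X
  proof -
    let ?j = "i - card X"
    have "card (C i X) * ?j \<le> (n choose ?j) * ?j" using cardC by simp
    also have "\<dots> = n * ((n - 1) choose (?j - 1))"
      using times_binomial_minus1_eq[of ?j n] that by (simp add: mult.commute)
    finally have "real (card (C i X)) * real ?j \<le> real n * real ((n - 1) choose (?j - 1))"
      by (metis of_nat_le_iff of_nat_mult)
    then have "sum w (C i X) \<le> real ((n - 1) choose (?j - 1))"
      using n by (simp add: wC divide_le_eq mult.commute)
    then have "\<lceil>sum w (C i X)\<rceil> \<le> int ((n - 1) choose (?j - 1))" by (simp add: ceiling_le_iff)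
    then have "sum x (C i X) \<le> int ((n - 1) choose (?j - 1))" using xC(2)[of i X] by linarith
    then show ?thesis using chosen[of i X] by simp
  qed
  \<comment> \<open>The complementary weights \<open>1 - w e\<close> total at most
    \<open>(n - 1) choose j\<close>, as
    \<open>(n - j) * (n choose j) = n * ((n - 1) choose j)\<close>; here the lower bound of the
    rounding is used.\<close>
  have lo: "card {e \<in> C i X. g (fst e) \<noteq> snd e} \<le> (n - 1) choose (i - card X)" for i X
  proof -
    let ?j = "i - card X"
    show ?thesis
    proof (cases "?j \<le> n")
      case True
      have "(n - ?j) * card (C i X) \<le> (n - ?j) * (n choose ?j)" using cardC by simp
      also have "\<dots> = n * ((n - 1) choose ?j)" by (rule binomial_absorb_comp)
      finally have "real ((n - ?j) * card (C i X)) \<le> real (n * ((n - 1) choose ?j))"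
        using of_nat_le_iff by blast
      then have "(real n - real ?j) * real (card (C i X)) \<le> real n * real ((n - 1) choose ?j)"
        using True by (simp add: of_nat_diff)
      then have "real (card (C i X)) - sum w (C i X) \<le> real ((n - 1) choose ?j)"
        using n by (simp add: wC field_simps)
      then have "int (card (C i X)) - int ((n - 1) choose ?j) \<le> \<lfloor>sum w (C i X)\<rfloor>"
        by (simp add: le_floor_iff)
      then have "int (card (C i X)) - int ((n - 1) choose ?j) \<le> int (card {e \<in> C i X. g (fst e) = snd e})"
        using xC(1)[of i X] chosen[of i X] by linarith
      moreover have "card (C i X) = card {e \<in> C i X. g (fst e) = snd e} + card {e \<in> C i X. g (fst e) \<noteq> snd e}"
        using finC[of i X] by (subst card_Un_disjoint[symmetric]) (auto intro: arg_cong[of _ _ card])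
      ultimately show ?thesis by linarith
    next
      case False
      then have "card (C i X) = 0" using cardC[of i X] by (simp add: binomial_eq_0)
      then show ?thesis using finC[of i X] by simp
    qed
  qed
  have "card {e \<in> E. h e = i \<and> block (Suc l) A' e = X} \<le> (N - Suc l) choose (i - card X)" for X i
  proof (cases "l \<in> X")
    case False
    then have "{e \<in> E. h e = i \<and> block (Suc l) A' e = X} = {e \<in> C i X. g (fst e) \<noteq> snd e}"
      by (auto simp: S' C_def split: if_splits)
    then show ?thesis using lo[of i X] n by simp
  next
    case True
    let ?Y = "X - {l}"
    have eq: "{e \<in> E. h e = i \<and> block (Suc l) A' e = X} = {e \<in> C i ?Y. g (fst e) = snd e}"
    proof -
      have "block (Suc l) A' e = X \<longleftrightarrow> S e = ?Y \<and> g (fst e) = snd e" for e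
        using True lS(1)[of e] unfolding S' by auto
      then show ?thesis by (auto simp: C_def)
    qed
    show ?thesis
    proof (cases "{e \<in> C i ?Y. g (fst e) = snd e} = {}")
      case False
      \<comment> \<open>Such an entry shows \<open>card X \<le> i\<close> through
        \<open>small\<close>, so the truncated subtractions are exact.\<close>
      then obtain e where e: "e \<in> E" "h e = i" "block (Suc l) A' e = X" unfolding eq[symmetric] by blast
      then have "finite X" "card X \<le> i" using small[OF e(1)] by auto
      moreover from this True have "Suc (card ?Y) = card X" by (intro card_Suc_Diff1)
      ultimately have "card ?Y < i" "i - card ?Y - 1 = i - card X" by auto
      then show ?thesis using up[of ?Y i] n eq by simp
    next
      case True
      show ?thesis unfolding eq True by simp
    qed
  qed
  moreover have "A' r \<gamma> < v" if "r < Suc l" "\<gamma> < k" for r \<gamma>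
    using that A(1) g(1) by (auto simp: A'_def less_Suc_eq)
  ultimately show ?case using small by blast
qed

text \<open>A set of at most one interaction is empty or a singleton. Comparing two singletons gives
  injectivity; comparing a singleton with the empty set gives nonempty blocks.\<close>

lemma is_locating_bar1_1_iff:
  assumes "is_array N k v S A"
  shows "is_locating_bar1_1 N k S A \<longleftrightarrow>
    inj_on (block N A) (SIGMA \<gamma>:{..<k}. S \<gamma>) \<and> (\<forall>e\<in>(SIGMA \<gamma>:{..<k}. S \<gamma>). block N A e \<noteq> {})"
    (is "_ \<longleftrightarrow> inj_on _ ?E \<and> _")
proof -
  have rho1: "rho_set N A {{e}} = block N A e" for e
    by (auto simp: rho_set_def rho_def block_def)
  have rho0: "rho_set N A {} = {}" by (simp add: rho_set_def)
  have one: "\<T> \<subseteq> one_way_interactions k S \<and> finite \<T> \<and> card \<T> \<le> 1 \<longleftrightarrow> \<T> = {} \<or> (\<exists>e\<in>?E. \<T> = {{e}})" for \<T>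
  proof
    assume a: "\<T> \<subseteq> one_way_interactions k S \<and> finite \<T> \<and> card \<T> \<le> 1"
    then have "card \<T> = 0 \<or> card \<T> = 1" by linarith
    then show "\<T> = {} \<or> (\<exists>e\<in>?E. \<T> = {{e}})"
      using a by (auto simp: card_1_singleton_iff one_way_interactions_def)
  qed (auto simp: one_way_interactions_def)
  have "is_locating_bar1_1 N k S A \<longleftrightarrow> (\<forall>\<T>1 \<T>2. (\<T>1 = {} \<or> (\<exists>e\<in>?E. \<T>1 = {{e}})) \<longrightarrow> (\<T>2 = {} \<or> (\<exists>e\<in>?E. \<T>2 = {{e}})) \<longrightarrow>
      (rho_set N A \<T>1 = rho_set N A \<T>2 \<longleftrightarrow> \<T>1 = \<T>2))"
    unfolding is_locating_bar1_1_def one[symmetric] by blast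
  also have "\<dots> \<longleftrightarrow> inj_on (block N A) ?E \<and> (\<forall>e\<in>?E. block N A e \<noteq> {})"
    (is "?L \<longleftrightarrow> ?R")
  proof
    assume L: ?L
    have "block N A e \<noteq> {}" if "e \<in> ?E" for e
      using L[rule_format, of "{}" "{{e}}"] that by (auto simp: rho1 rho0)
    moreover have "e = e'" if "e \<in> ?E" "e' \<in> ?E" "block N A e = block N A e'" for e e'
    proof -
      have "{{e}} = {{e'}}" using L[rule_format, of "{{e}}" "{{e'}}"] that unfolding rho1 by blast
      then show ?thesis by simp
    qed
    ultimately show ?R unfolding inj_on_def by blast
  next
    assume R: ?R
    then have inj: "\<And>e e'. e \<in> ?E \<Longrightarrow> e' \<in> ?E \<Longrightarrow> block N A e = block N A e' \<Longrightarrow> e = e'"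
      and ne: "\<And>e. e \<in> ?E \<Longrightarrow> block N A e \<noteq> {}" by (auto simp del: mem_Sigma_iff dest: inj_onD)
    show ?L
    proof (intro allI impI iffI)
      fix \<T>1 \<T>2
      assume a: "\<T>1 = {} \<or> (\<exists>e\<in>?E. \<T>1 = {{e}})" "\<T>2 = {} \<or> (\<exists>e\<in>?E. \<T>2 = {{e}})"
        "rho_set N A \<T>1 = rho_set N A \<T>2"
      from a(1) show "\<T>1 = \<T>2"
      proof
        assume "\<T>1 = {}"
        with a(2,3) ne show ?thesis by (metis rho0 rho1)
      next
        assume "\<exists>e\<in>?E. \<T>1 = {{e}}"
        then obtain e where e: "e \<in> ?E" "\<T>1 = {{e}}" by blast
        from a(2) show ?thesis
        proof
          assume "\<T>2 = {}"
          with e a(3) ne[OF e(1)] show ?thesis by (simp add: rho0 rho1)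
        next
          assume "\<exists>e\<in>?E. \<T>2 = {{e}}"
          then obtain e' where "e' \<in> ?E" "\<T>2 = {{e'}}" by blast
          with e a(3) inj[OF e(1), of e'] show ?thesis by (simp add: rho1)
        qed
      qed
    qed auto
  qed
  finally show ?thesis .
qed

text \<open>At \<open>l = N\<close> the column sums force equality in
  \<open>card (block N A e) \<le> h e\<close>, and the capacity for the block of an entry becomes
  \<open>0 choose 0 = 1\<close>, so no two entries share a block.\<close>

theorem locating_sizes_of_block_sizes:
  fixes T :: "nat list list"
  assumes col: "\<And>c. c \<in> set T \<Longrightarrow> length c = v \<and> sum_list c = N \<and> 0 \<notin> set c"
    and cap: "\<And>i. (\<Sum>c\<leftarrow>T. count_list c i) \<le> N choose i"
  shows "length T \<in> locating_sizes N v"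
proof -
  define k where "k = length T"
  define h where "h e = T ! fst e ! snd e" for e :: "nat \<times> nat"
  have T: "length (T ! \<gamma>) = v" "sum_list (T ! \<gamma>) = N" "0 \<notin> set (T ! \<gamma>)" if "\<gamma> < k" for \<gamma>
    using col[of "T ! \<gamma>"] that by (auto simp: k_def)
  have colsum: "(\<Sum>\<sigma><v. h (\<gamma>, \<sigma>)) = N" if "\<gamma> < k" for \<gamma>
    using T[OF that] by (simp add: h_def sum_list_sum_nth atLeast0LessThan)
  have "card {e \<in> {..<k} \<times> {..<v}. h e = i} \<le> N choose i" for i
  proof -
    have "{e \<in> {..<k} \<times> {..<v}. h e = i} = (SIGMA \<gamma>:{..<k}. {\<sigma>. \<sigma> < length (T ! \<gamma>) \<and> i = T ! \<gamma> ! \<sigma>})"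
      using T(1) by (auto simp: h_def)
    then have "card {e \<in> {..<k} \<times> {..<v}. h e = i} = (\<Sum>\<gamma><k. count_list (T ! \<gamma>) i)"
      by (simp add: count_list_eq_length_filter length_filter_conv_card)
    also have "\<dots> = (\<Sum>c\<leftarrow>T. count_list c i)"
      by (simp add: sum_list_sum_nth atLeast0LessThan k_def)
    finally show ?thesis using cap by simp
  qed
  then obtain A :: "nat \<Rightarrow> nat \<Rightarrow> nat" where
    A: "\<And>r \<gamma>. r < N \<Longrightarrow> \<gamma> < k \<Longrightarrow> A r \<gamma> < v"
      "\<And>e. e \<in> {..<k} \<times> {..<v} \<Longrightarrow> card (block N A e) \<le> h e"
    and cnt: "\<And>X i. card {e \<in> {..<k} \<times> {..<v}. h e = i \<and> block N A e = X} \<le> (N - N) choose (i - card X)"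
    using baranyai_extension[where k = k and v = v and h = h and N = N and l = N] colsum by blast
  have h: "card (block N A e) = h e" if eE: "e \<in> {..<k} \<times> {..<v}" for e
  proof (rule ccontr)
    assume "card (block N A e) \<noteq> h e"
    then have lt: "card (block N A e) < h e" using A(2)[OF that] by simp
    obtain \<gamma> \<sigma> where e: "e = (\<gamma>, \<sigma>)" "\<gamma> < k" "\<sigma> < v" using eE by auto
    have "(\<Sum>\<sigma><v. card (block N A (\<gamma>, \<sigma>))) < (\<Sum>\<sigma><v. h (\<gamma>, \<sigma>))"
      using A(2) e lt by (intro sum_strict_mono_ex1) auto
    then show False using colsum[OF e(2)] sum_card_block[of "{..<v}" N A \<gamma>] A(1) e by simp
  qed
  have arr: "is_array N k v (\<lambda>_. {..<v}) A" using A(1) by (auto simp: is_array_def)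
  have "inj_on (block N A) ({..<k} \<times> {..<v})"
  proof (rule inj_onI)
    fix e e' assume ee: "e \<in> {..<k} \<times> {..<v}" "e' \<in> {..<k} \<times> {..<v}" "block N A e = block N A e'"
    let ?C = "{a \<in> {..<k} \<times> {..<v}. h a = h e \<and> block N A a = block N A e}"
    have "card ?C \<le> 1" using cnt[of "h e" "block N A e"] h[OF ee(1)] by simp
    moreover have "e \<in> ?C" "e' \<in> ?C" using ee h[OF ee(1)] h[OF ee(2)] by auto
    moreover have "finite ?C" by simp
    ultimately show "e = e'" unfolding One_nat_def by (metis (no_types, lifting) card_le_Suc0_iff_eq)
  qed
  moreover have "block N A e \<noteq> {}" if "e \<in> {..<k} \<times> {..<v}" for e
  proof -
    have "h e \<in> set (T ! fst e)" using that T(1)[of "fst e"] by (auto simp: h_def)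
    then have "h e \<noteq> 0" using that T(3)[of "fst e"] by (metis SigmaE fst_conv lessThan_iff)
    then show ?thesis using h[OF that] by auto
  qed
  ultimately have "is_locating_bar1_1 N k (\<lambda>_. {..<v}) A"
    using is_locating_bar1_1_iff[OF arr] by blast
  with arr show ?thesis unfolding k_def locating_sizes_def by blast
qed

section \<open>The upper bound\<close>

text \<open>One entry of truncated weight \<open>d\<close> suffices. Otherwise nothing is cut off at
  \<open>d\<close>, and truncated subtraction only replaces negative differences by 0, while the
  exact differences sum to \<open>d\<close>.\<close>

lemma sum_truncated_weights_ge:
  fixes a :: "'s \<Rightarrow> nat"
  assumes "finite V" "sum a V + d = c * card V"
  shows "d \<le> (\<Sum>s\<in>V. min d (c - a s))"
proof (cases "\<exists>s\<in>V. d \<le> c - a s")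
  case True
  then obtain s where s: "s \<in> V" "d \<le> c - a s" by blast
  then have "d \<le> min d (c - a s)" by simp
  also have "\<dots> \<le> (\<Sum>s\<in>V. min d (c - a s))" using assms s by (intro member_le_sum) auto
  finally show ?thesis .
next
  case False
  have "sum a V + d = (\<Sum>s\<in>V. c)" using assms by simp
  also have "\<dots> \<le> (\<Sum>s\<in>V. a s + min d (c - a s))" using False by (intro sum_mono) force
  also have "\<dots> = sum a V + (\<Sum>s\<in>V. min d (c - a s))" by (rule sum.distrib)
  finally show ?thesis by simp
qed

theorem locating_sizes_upper_bound:
  assumes k: "k \<in> locating_sizes N v" and N: "N + d = (f + 1) * v"
  shows "d * k \<le> (\<Sum>i=1..f. min d (f + 1 - i) * (N choose i))"
proof -
  from k obtain S :: "nat \<Rightarrow> nat set" and A where arr: "is_array N k v S A" and loc: "is_locating_bar1_1 N k S A"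
    by (auto simp: locating_sizes_def)
  define E where "E = (SIGMA \<gamma>:{..<k}. S \<gamma>)"
  define wt where "wt X = min d (f + 1 - card X)" for X :: "nat set"
  have S: "finite (S \<gamma>)" "card (S \<gamma>) = v" "\<And>r. r < N \<Longrightarrow> A r \<gamma> \<in> S \<gamma>" if "\<gamma> < k" for \<gamma>
    using arr that by (auto simp: is_array_def)
  have inj: "inj_on (block N A) E" and ne: "\<And>e. e \<in> E \<Longrightarrow> block N A e \<noteq> {}"
    using loc unfolding is_locating_bar1_1_iff[OF arr] E_def by blast+
  have "d * k = (\<Sum>\<gamma><k. d)" by simp
  also have "\<dots> \<le> (\<Sum>\<gamma><k. \<Sum>\<sigma>\<in>S \<gamma>. wt (block N A (\<gamma>, \<sigma>)))"
    unfolding wt_def using S sum_card_block[of _ N A] N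
    by (intro sum_mono sum_truncated_weights_ge) auto
  also have "\<dots> = (\<Sum>e\<in>E. wt (block N A e))"
    unfolding E_def using S by (subst sum.Sigma) auto
  also have "\<dots> = sum wt (block N A ` E)" using inj by (simp add: sum.reindex)
  also have "\<dots> \<le> sum wt (Pow {..<N} - {{}})"
    using ne by (intro sum_mono2) (auto simp: block_def)
  also have "\<dots> = (\<Sum>i=1..N. sum wt {X \<in> Pow {..<N} - {{}}. card X = i})"
  proof (rule sum.group[symmetric])
    show "card ` (Pow {..<N} - {{}}) \<subseteq> {1..N}"
    proof
      fix i assume "i \<in> card ` (Pow {..<N} - {{}})"
      then obtain X where X: "X \<subseteq> {..<N}" "X \<noteq> {}" "i = card X" by auto
      have "finite X" using X finite_subset by blast
      with X have "1 \<le> card X" by (simp add: Suc_le_eq card_gt_0_iff)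
      moreover have "card X \<le> N" using card_mono[OF _ X(1)] by simp
      ultimately show "i \<in> {1..N}" using X by simp
    qed
  qed auto
  also have "\<dots> = (\<Sum>i=1..N. min d (f + 1 - i) * (N choose i))"
  proof (intro sum.cong refl)
    fix i assume i: "i \<in> {1..N}"
    have "sum wt {X \<in> Pow {..<N} - {{}}. card X = i} = (\<Sum>X\<in>{X. X \<subseteq> {..<N} \<and> card X = i}. min d (f + 1 - i))"
      using i by (intro sum.cong) (auto simp: wt_def)
    then show "sum wt {X \<in> Pow {..<N} - {{}}. card X = i} = min d (f + 1 - i) * (N choose i)"
      by (simp add: n_subsets)
  qed
  also have "\<dots> = (\<Sum>i\<in>{1..N} \<inter> {1..f}. min d (f + 1 - i) * (N choose i))"
    by (intro sum.mono_neutral_right) auto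
  also have "\<dots> \<le> (\<Sum>i=1..f. min d (f + 1 - i) * (N choose i))" by (intro sum_mono2) auto
  finally show ?thesis .
qed

section \<open>Packing block sizes into columns\<close>

lemma count_list_replicate: "count_list (replicate m x) y = (if x = y then m else 0)"
  by (induction m) auto

lemma sum_list_concat_replicate:
  fixes g :: "'b \<Rightarrow> nat"
  shows "(\<Sum>c\<leftarrow>concat (map (\<lambda>w. replicate (a w) (X w)) [i..<j]). g c) = (\<Sum>w=i..<j. a w * g (X w))"
proof -
  have "(\<Sum>c\<leftarrow>concat (map (\<lambda>w. replicate (a w) (X w)) ws). g c) = (\<Sum>w\<leftarrow>ws. a w * g (X w))" for ws
    by (induction ws) (auto simp: sum_list_replicate)
  then show ?thesis by (simp add: interv_sum_list_conv_sum_set_nat)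
qed

text \<open>Binomial coefficients increase up to the middle; a \<open>j\<close> beyond it is
  reflected to \<open>N - j\<close>, which is still at least \<open>i\<close>.\<close>

lemma binomial_le_binomial:
  assumes "i \<le> j" "i + j \<le> (N::nat)"
  shows "N choose i \<le> N choose j"
proof (cases "2 * j \<le> N")
  case True
  then show ?thesis using assms by (intro binomial_mono) auto
next
  case False
  have "N choose i \<le> N choose (N - j)" using assms False by (intro binomial_mono) auto
  then show ?thesis using assms by (simp add: binomial_symmetric[of j N])
qed

lemma Suc_times_binomial_Suc: "Suc k * (N choose Suc k) = (N - k) * (N choose k)"
  by (simp only: binomial_absorption binomial_absorb_comp)

text \<open>The range of \<open>d\<close> reflects the choice of \<open>f\<close> as a quotient: if
  \<open>r\<close> is the remainder of \<open>N + 1\<close> modulo \<open>v\<close>, then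
  \<open>d = v + 1 - r\<close>.\<close>

locale block_weights =
  fixes N v f d :: nat
  assumes v: "2 \<le> v" "v \<le> N" and d: "2 \<le> d" "d \<le> v + 1" and N: "N + d = (f + 1) * v"
begin

text \<open>Blocks of size \<open>f + 1 - w\<close> have weight \<open>w\<close>, and \<open>n w\<close> is the number of nonempty sets of positive
  weight \<open>w\<close>.\<close>

definition n :: "nat \<Rightarrow> nat" where
  "n w = (if 1 \<le> w \<and> w \<le> f then N choose (f + 1 - w) else 0)"

section \<open>Ratios and tails of the numbers \<open>n w\<close>\<close>

lemma f_ge_1: "1 \<le> f"
  using v d N by (cases f) auto

lemma f_ge_2: "d = v + 1 \<Longrightarrow> 2 \<le> f"
  using v N f_ge_1 by (cases "f = 1") auto

text \<open>For \<open>s = f - w\<close> the ratio of the two binomials is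
  \<open>(N - s) / (s + 1)\<close>. From \<open>w \<ge> 1\<close> and \<open>d \<le> v + 1\<close>
  it follows that \<open>N \<ge> (s + 1) * v - 1 = (v - 1) * (s + 1) + s\<close>.\<close>

lemma n_ratio:
  assumes "1 \<le> w"
  shows "(v - 1) * n (w + 1) \<le> n w"
proof (cases "w + 1 \<le> f")
  case True
  define s where "s = f - w"
  have f: "f = s + w" using True by (simp add: s_def)
  have n: "n (w + 1) = N choose s" "n w = N choose Suc s"
    using True assms by (auto simp: n_def s_def Suc_diff_le)
  have "v * 1 \<le> v * w" using assms by (intro mult_left_mono) auto
  then have "(v - 1) * Suc s + s \<le> N"
    using N d v(1) by (cases v) (auto simp: f algebra_simps)
  then have "(v - 1) * Suc s \<le> N - s" by simp
  then have "Suc s * ((v - 1) * (N choose s)) \<le> (N - s) * (N choose s)"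
    by (metis mult.assoc mult.commute mult_le_mono1)
  also have "\<dots> = Suc s * (N choose Suc s)" by (rule Suc_times_binomial_Suc[symmetric])
  finally show ?thesis unfolding n by (simp only: Suc_mult_le_cancel1)
next
  case False
  then show ?thesis by (simp add: n_def)
qed

lemma n_antimono:
  assumes "1 \<le> a" "a \<le> b"
  shows "n b \<le> n a"
  using assms(2)
proof (induction b rule: dec_induct)
  case (step b)
  have "1 * n (b + 1) \<le> (v - 1) * n (b + 1)" using v by (intro mult_le_mono1) auto
  also have "\<dots> \<le> n b" using n_ratio[of b] assms step by simp
  finally show ?case using step by simp
qed simp

text \<open>Telescoping sum of \<open>(v - 2) * n (b + 1) \<le> n b - n (b + 1)\<close>, which is a
  form of \<open>n_ratio\<close>.\<close>

lemma n_tail: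
  assumes "1 \<le> a" "a \<le> b"
  shows "(v - 2) * (\<Sum>w=a+1..<b+1. n w) + n b \<le> n a"
  using assms(2)
proof (induction b rule: dec_induct)
  case (step b)
  have "(v - 2) * n (b + 1) + n (b + 1) = (v - 1) * n (b + 1)" using v by (cases v) (auto simp: algebra_simps)
  also have "\<dots> \<le> n b" using n_ratio[of b] assms step by simp
  finally have 1: "(v - 2) * n (b + 1) + n (b + 1) \<le> n b" .
  have "(\<Sum>w=a+1..<Suc b+1. n w) = (\<Sum>w=a+1..<b+1. n w) + n (b + 1)" using step by simp
  then show ?case using 1 step.IH by (simp add: distrib_left)
qed simp

text \<open>Any upper summation bound beyond \<open>f\<close> and \<open>d\<close> would do for \<open>U\<close>, since \<open>n w = 0\<close> for \<open>w > f\<close>.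
  \<open>B\<close> is the number of bins of capacity \<open>d\<close> that the sets of weight below \<open>d\<close> have to fill; the
  \<open>Big\<close> sets of weight at least \<open>d\<close> get a column each.\<close>

definition U :: nat where "U = f + d + 1"

definition M :: nat where "M = (\<Sum>w=2..<d. n w)"
definition M3 :: nat where "M3 = (\<Sum>w=3..<d. n w)"
definition W2 :: nat where "W2 = (\<Sum>w=2..<d. w * n w)"
definition B :: nat where "B = (n 1 + W2) div d"
definition Big :: nat where "Big = (\<Sum>w=d..<U. n w)"

section \<open>Number of bins against numbers of sets\<close>

lemma B_le: "d * B \<le> n 1 + W2"
  by (simp add: B_def)

lemma d_ge_3_split:
  assumes "3 \<le> d"
  shows "M = n 2 + M3" "W2 = 2 * n 2 + (\<Sum>w=3..<d. w * n w)"
  using assms by (auto simp: M_def M3_def W2_def sum.atLeast_Suc_lessThan numeral_3_eq_3 numeral_2_eq_2)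

text \<open>There are enough sets of weight 1 to give each set of weight 2 a bin of its own: it
  needs \<open>d - 2 \<le> v - 1\<close> of them, and \<open>n_ratio\<close> supplies
  \<open>v - 1\<close>.\<close>

lemma n2_le_B:
  assumes "3 \<le> d"
  shows "n 2 \<le> B"
proof -
  have "(d - 2) * n 2 \<le> (v - 1) * n 2" using d by (intro mult_le_mono1) auto
  also have "\<dots> \<le> n 1" using n_ratio[of 1] by (simp add: numeral_2_eq_2)
  finally have "(d - 2) * n 2 + 2 * n 2 \<le> n 1 + W2" unfolding d_ge_3_split[OF assms] by simp
  moreover have "(d - 2) * n 2 + 2 * n 2 = n 2 * d" using assms by (simp add: algebra_simps diff_mult_distrib)
  ultimately have "n 2 * d \<le> n 1 + W2" by simp
  then show ?thesis unfolding B_def using d by (simp add: less_eq_div_iff_mult_less_eq)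
qed

text \<open>For \<open>v \<ge> 4\<close> the tail bound suffices. The only other nontrivial case is
  \<open>v = 3\<close>, \<open>d = 4\<close>, where the extra term \<open>n (d - 1)\<close> is
  \<open>M3\<close> itself.\<close>

lemma two_M3_le: "3 \<le> d \<Longrightarrow> 2 * M3 \<le> n 2"
proof -
  assume d3: "3 \<le> d"
  have t: "(v - 2) * M3 + n (d - 1) \<le> n 2"
    using n_tail[of 2 "d - 1"] d3 by (simp add: M3_def)
  consider "d = 3" | "d = 4" "v = 3" | "v \<ge> 4" using d d3 by linarith
  then show ?thesis
  proof cases
    case 1 then show ?thesis unfolding M3_def by simp
  next
    case 2
    then have "M3 = n 3" unfolding M3_def by (simp add: numeral_eq_Suc)
    then show ?thesis using t 2 by simp
  next
    case 3
    then have "2 * M3 \<le> (v - 2) * M3" by (intro mult_le_mono1) auto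
    then show ?thesis using t by linarith
  qed
qed

text \<open>Since \<open>n 2 \<le> B\<close>, the surplus over the bins is at most
  \<open>M3\<close>, and \<open>two_M3_le\<close> leaves enough sets of weight 2 to pair it off. Two
  of these fit into a bin only for \<open>d \<ge> 4\<close>, hence the second claim.\<close>

lemma M_minus_B_le: "2 * (M - B) \<le> n 2" "d < 4 \<Longrightarrow> M \<le> B"
proof -
  have "M = 0" if "d = 2" unfolding M_def using that by simp
  moreover have "M3 = 0" if "d = 3" unfolding M3_def using that by simp
  ultimately show "2 * (M - B) \<le> n 2" "d < 4 \<Longrightarrow> M \<le> B"
    using d two_M3_le n2_le_B d_ge_3_split(1) by (cases "d = 2"; force)+
qed

text \<open>A \<open>flat_col\<close> has \<open>d\<close> blocks of size \<open>f\<close>, too many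
  for \<open>d = v + 1\<close>, so every bin needs a set of weight at least 2. Here
  \<open>n_ratio\<close> is an equality for \<open>w = 1\<close>, so
  \<open>n 1 + 2 * n 2 = d * n 2\<close>, and the remaining weights are below
  \<open>d\<close>.\<close>

lemma B_le_M:
  assumes dv: "d = v + 1"
  shows "B \<le> M"
proof -
  have d3: "3 \<le> d" using dv v by simp
  obtain s where s: "f = Suc (Suc s)" using f_ge_2[OF dv] by (metis add_2_eq_Suc le_Suc_ex)
  have N1: "N + 1 = f * v" using N dv by (simp add: algebra_simps)
  then have "N - Suc s = f * (v - 1)" using v by (cases v) (auto simp: s algebra_simps)
  then have "f * (N choose f) = f * ((v - 1) * (N choose Suc s))"
    using Suc_times_binomial_Suc[of "Suc s" N] unfolding s by (simp only: mult.assoc)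
  moreover have "N choose Suc s = N choose (f - 1)" by (simp add: s)
  ultimately have "N choose f = (v - 1) * (N choose (f - 1))" using f_ge_1 by (simp only: mult_cancel1) simp
  then have "n 1 = (d - 2) * n 2" using f_ge_2[OF dv] dv by (simp add: n_def)
  then have "n 1 + W2 = d * n 2 + (\<Sum>w=3..<d. w * n w)"
    unfolding d_ge_3_split[OF d3] using le_Suc_ex[OF d3] by (auto simp: algebra_simps)
  also have "\<dots> \<le> d * n 2 + (\<Sum>w=3..<d. d * n w)" by (intro add_left_mono sum_mono) auto
  also have "\<dots> = d * M" unfolding d_ge_3_split[OF d3] by (simp add: M3_def sum_distrib_left distrib_left)
  finally have "(n 1 + W2) div d \<le> (d * M) div d" by (rule div_le_mono)
  then show ?thesis using d by (simp add: B_def)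
qed

lemma n_eq_0: "f < w \<Longrightarrow> n w = 0"
  by (simp add: n_def)

lemma M3_Big_le: "3 \<le> d \<Longrightarrow> (v - 2) * (M3 + Big) \<le> n 2"
proof -
  assume d3: "3 \<le> d"
  have "M3 + Big = (\<Sum>w=3..<U. n w)"
    unfolding M3_def Big_def using d3 by (intro sum.atLeastLessThan_concat) (auto simp: U_def)
  then show ?thesis using n_tail[of 2 "U - 1"] d3 by (simp add: U_def)
qed

lemma M_Big_le: "(v - 2) * (M + Big) \<le> (v - 1) * n 2"
proof -
  have "M + Big = (\<Sum>w=2..<U. n w)"
    unfolding M_def Big_def using d by (intro sum.atLeastLessThan_concat) (auto simp: U_def)
  also have "\<dots> = n 2 + (\<Sum>w=3..<U. n w)"
    using d f_ge_1 by (subst sum.atLeast_Suc_lessThan) (auto simp: U_def numeral_3_eq_3 numeral_2_eq_2)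
  finally have "M + Big = n 2 + (\<Sum>w=3..<U. n w)" .
  moreover have "(v - 2) * (\<Sum>w=3..<U. n w) \<le> n 2"
    using n_tail[of 2 "U - 1"] d by (simp add: U_def)
  moreover have "(v - 1) * n 2 = (v - 2) * n 2 + n 2" using v by (cases v) (auto simp: algebra_simps)
  ultimately show ?thesis by (simp add: distrib_left)
qed

section \<open>Enough sets of size \<open>f + 1\<close> to complete the columns\<close>

lemma n_d_le_Big: "n d \<le> Big"
  unfolding Big_def by (intro member_le_sum) (auto simp: U_def)

lemma n0_eq: "(f + 1) * (N choose (f + 1)) = (N - f) * n 1"
  using Suc_times_binomial_Suc[of f N] f_ge_1 by (simp add: n_def)

text \<open>\<open>Z1\<close> and \<open>Z\<close> stand for the numbers of weight-\<open>1\<close> and weight-\<open>0\<close> blocks in the bins. The bound is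
  asymptotically sharp, for instance for \<open>v = 3\<close>, \<open>d = 2\<close> and \<open>f \<rightarrow> \<infinity>\<close>, so the exact ratio of
  consecutive binomial coefficients is needed there.\<close>

lemma zero_blocks_le:
  assumes Z1: "Z + Z1 + M = v * B" and Z2: "Z1 + W2 = d * B"
  shows "Z + (v - 2) * Big + n d \<le> N choose (f + 1)" (is "?X \<le> ?n0")
proof -
  \<comment> \<open>Eliminating \<open>Z1\<close> gives \<open>Z + M = (v - d) * B + W2\<close>;
    then \<open>B_le\<close> removes \<open>B\<close>, and \<open>v * w \<le> (v - 1) * d\<close>
    for \<open>w < d\<close> compares \<open>W2\<close> with \<open>M\<close>.\<close>
  have dX: "d * ?X \<le> (v - d) * n 1 + d * ((v - 1) * n 2) + d * n d" if dv: "d \<le> v"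
  proof -
    obtain a where a: "v = d + a" using le_Suc_ex[OF dv] by blast
    have "v * W2 = (\<Sum>w=2..<d. v * w * n w)" by (simp add: W2_def sum_distrib_left mult.assoc)
    also have "\<dots> \<le> (\<Sum>w=2..<d. (v - 1) * d * n w)"
    proof (intro sum_mono mult_le_mono1)
      fix w assume w: "w \<in> {2..<d}"
      then have "v * w \<le> v * (d - 1)" by (intro mult_le_mono2) auto
      also have "\<dots> \<le> (v - 1) * d" using dv d by (simp add: diff_mult_distrib diff_mult_distrib2)
      finally show "v * w \<le> (v - 1) * d" .
    qed
    finally have W: "v * W2 \<le> (v - 1) * d * M" by (simp add: M_def sum_distrib_left)
    have "Z + M = a * B + W2" using Z1 Z2 a by (simp add: distrib_right)
    then have "d * (Z + M) = a * (d * B) + d * W2" by (simp add: distrib_left mult.left_commute)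
    also have "\<dots> \<le> a * (n 1 + W2) + d * W2" by (intro add_right_mono mult_le_mono2 B_le)
    also have "\<dots> = a * n 1 + v * W2" by (simp add: a algebra_simps)
    also have "\<dots> \<le> a * n 1 + (v - 1) * d * M" using W by simp
    also have "(v - 1) * d * M = d * ((v - 2) * M) + d * M"
    proof -
      obtain u where "v = u + 2" using le_Suc_ex[OF v(1)] by (auto simp: add.commute)
      then show ?thesis by (simp add: algebra_simps)
    qed
    finally have "d * Z \<le> a * n 1 + d * ((v - 2) * M)" by (simp add: distrib_left)
    then have "d * ?X \<le> a * n 1 + d * ((v - 2) * (M + Big)) + d * n d" by (simp add: distrib_left)
    also have "\<dots> \<le> a * n 1 + d * ((v - 1) * n 2) + d * n d"
      using M_Big_le by (intro add_right_mono add_left_mono mult_le_mono2)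
    finally show ?thesis using a by simp
  qed
  consider "v = 2" | "v \<ge> 3" "d = v + 1" | "v \<ge> 3" "d = 2" "d \<le> v" | "v \<ge> 3" "d \<ge> 3" "d \<le> v" using v d by linarith
  then show ?thesis
  proof cases
    case 1
    then consider "d = 2" | "d = 3" using d by linarith
    then show ?thesis
    proof cases
      case c: 1
      then have "M = 0" "W2 = 0" unfolding M_def W2_def by auto
      then have "Z = 0" using Z1 Z2 1 c by simp
      moreover have "n 2 \<le> N choose (f + 1)"
        unfolding n_def using N 1 c by (auto intro!: binomial_le_binomial)
      ultimately show ?thesis using 1 c by simp
    next
      case c: 2
      then have "M = n 2" "W2 = 2 * n 2" "n 2 \<le> B"
        using d_ge_3_split n2_le_B unfolding M3_def by auto
      then have "Z = 0" using Z1 Z2 1 c by simp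
      moreover have "n 3 \<le> N choose (f + 1)"
        unfolding n_def using N 1 c by (auto intro!: binomial_le_binomial)
      ultimately show ?thesis using 1 c by simp
    qed
  next
    case 2
    have d3: "3 \<le> d" using 2 by simp
    have "(\<Sum>w=3..<d. w * n w) \<le> (\<Sum>w=3..<d. v * n w)" using 2 by (intro sum_mono) auto
    then have W: "W2 \<le> 2 * n 2 + v * M3" unfolding d_ge_3_split[OF d3] M3_def by (simp add: sum_distrib_left)
    have "Z + M + B = W2" using Z1 Z2 2 by simp
    then have "Z + M3 \<le> v * M3" using W n2_le_B[OF d3] d_ge_3_split(1)[OF d3] by linarith
    then have "Z + (v - 2) * Big + n d \<le> (v - 1) * M3 + (v - 2) * Big + Big"
      using n_d_le_Big 2 by (simp add: diff_mult_distrib)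
    also have "\<dots> = (v - 1) * (M3 + Big)"
    proof -
      obtain u where "v = u + 2" using le_Suc_ex[OF v(1)] by (auto simp: add.commute)
      then show ?thesis by (simp add: algebra_simps)
    qed
    also have "\<dots> \<le> n 1"
    proof -
      have "1 * ((v - 1) * (M3 + Big)) \<le> (v - 2) * ((v - 1) * (M3 + Big))"
        using 2 by (intro mult_le_mono1) simp
      also have "\<dots> = (v - 1) * ((v - 2) * (M3 + Big))" by (simp add: mult.left_commute)
      also have "\<dots> \<le> (v - 1) * n 2" using M3_Big_le[OF d3] by (intro mult_le_mono2)
      also have "\<dots> \<le> n 1" using n_ratio[of 1] by (simp add: numeral_2_eq_2)
      finally show ?thesis by simp
    qed
    also have "n 1 \<le> N choose (f + 1)"
    proof -
      have f2: "2 \<le> f" using f_ge_2 2 by simp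
      have "3 * f \<le> v * f" using 2 by simp
      moreover have "N + 1 = v * f" using N 2 by (simp add: algebra_simps)
      ultimately have "f + 1 \<le> N - f" using f2 by linarith
      then have "(f + 1) * n 1 \<le> (f + 1) * (N choose (f + 1))" unfolding n0_eq by (intro mult_le_mono1)
      then show ?thesis by (rule mult_left_le_imp_le) simp
    qed
    finally show ?thesis .
  next
    case 3
    obtain t where t: "v = t + 3" using le_Suc_ex[OF 3(1)] by (auto simp: add.commute)
    have X: "2 * ?X \<le> (t + 1) * n 1 + 2 * (t + 3) * n 2"
      using dX[OF 3(3)] 3 t by (simp add: algebra_simps)
    \<comment> \<open>For \<open>f \<ge> 2\<close> this is the exact ratio, from
      \<open>N - f + 1 = (t + 2) * (f + 1)\<close>; \<open>n_ratio\<close> would lose a factor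
      \<open>(f + 1) / f\<close>.\<close>
    have n2: "(t + 2) * (f + 1) * n 2 \<le> f * n 1"
    proof (cases "2 \<le> f")
      case True
      then obtain s where s: "f = Suc (Suc s)" by (metis add_2_eq_Suc le_Suc_ex)
      have "N - Suc s = (t + 2) * (f + 1)" using N 3 t by (simp add: s algebra_simps)
      then have "f * (N choose f) = (t + 2) * (f + 1) * (N choose Suc s)"
        using Suc_times_binomial_Suc[of "Suc s" N] unfolding s by (simp only:)
      moreover have "n 1 = N choose f" "n 2 = N choose Suc s" unfolding n_def using s by auto
      ultimately show ?thesis by (simp only:)
    qed (simp add: n_def)
    have "N - f + 1 = (f + 1) * (t + 2)" using N 3 t by (simp add: algebra_simps)
    moreover have "(f + 1) * ?n0 + n 1 = (N - f + 1) * n 1" unfolding n0_eq by simp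
    ultimately have n0: "(f + 1) * ?n0 + n 1 = (f + 1) * (t + 2) * n 1" by (simp only:)
    let ?c = "2 * (t + 2) * (f + 1)"
    have "?c * ?X \<le> (t + 2) * (f + 1) * ((t + 1) * n 1 + 2 * (t + 3) * n 2)"
      using mult_le_mono2[OF X, of "(t + 2) * (f + 1)"] by (simp only: mult_ac)
    also have "\<dots> = (t + 2) * (f + 1) * (t + 1) * n 1 + 2 * (t + 3) * ((t + 2) * (f + 1) * n 2)"
      by (simp add: algebra_simps)
    also have "\<dots> \<le> (t + 2) * (f + 1) * (t + 1) * n 1 + 2 * (t + 3) * (f * n 1)"
      by (intro add_left_mono mult_le_mono2 n2)
    finally have cX: "?c * ?X \<le> (t + 2) * (f + 1) * (t + 1) * n 1 + 2 * (t + 3) * (f * n 1)" .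
    \<comment> \<open>The slack is \<open>((f + 1) * (t * t + 3 * t) + 2) * n 1\<close>, which for
      \<open>v = 3\<close>, that is \<open>t = 0\<close>, shrinks to \<open>2 * n 1\<close>.\<close>
    have "(t + 2) * (f + 1) * (t + 1) * n 1 + 2 * (t + 3) * (f * n 1)
        + ((f + 1) * (t * t + 3 * t) + 2) * n 1 + 2 * (t + 2) * n 1 = 2 * (t + 2) * ((f + 1) * (t + 2) * n 1)"
      by (simp add: algebra_simps)
    then have "(t + 2) * (f + 1) * (t + 1) * n 1 + 2 * (t + 3) * (f * n 1) + 2 * (t + 2) * n 1
        \<le> 2 * (t + 2) * ((f + 1) * ?n0 + n 1)" unfolding n0 by linarith
    moreover have "2 * (t + 2) * ((f + 1) * ?n0 + n 1) = ?c * ?n0 + 2 * (t + 2) * n 1"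
      by (simp add: algebra_simps)
    ultimately have "?c * ?X \<le> ?c * ?n0" using cX by linarith
    then show ?thesis by (rule mult_left_le_imp_le) simp
  next
    case 4
    obtain a where a: "v = d + a" using le_Suc_ex[OF 4(3)] by blast
    obtain c where c: "d = c + 3" using le_Suc_ex[OF 4(2)] by (auto simp: add.commute)
    have X: "d * ?X \<le> a * n 1 + d * ((v - 1) * n 2) + d * n d" using dX[OF 4(3)] a by simp
    show ?thesis
    proof (cases "2 \<le> f")
      \<comment> \<open>For \<open>f = 1\<close> all sets of positive weight have weight 1. This
        case is separate because \<open>f + 1 \<ge> 3\<close> is used below.\<close>
      case False
      then have f: "f = 1" using f_ge_1 by simp
      have "2 * ?X \<le> d * ?X" using 4 by (intro mult_le_mono1) simp
      also have "\<dots> \<le> a * n 1"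
      proof -
        have "f < 2" "f < d" using f 4 by auto
        then have "n 2 = 0" "n d = 0" by (simp_all only: n_eq_0)
        then show ?thesis using X by simp
      qed
      also have "\<dots> \<le> (N - f) * n 1" using N a f c by (intro mult_le_mono1) simp
      also have "\<dots> = 2 * ?n0" using n0_eq f by simp
      finally show ?thesis by simp
    next
      case True
      have n21: "(v - 1) * n 2 \<le> n 1" using n_ratio[of 1] by (simp add: numeral_2_eq_2)
      have "2 * n 2 \<le> (v - 1) * n 2" "2 * n 3 \<le> (v - 1) * n 3"
        using 4 by (auto intro!: mult_le_mono1)
      moreover have "(v - 1) * n 3 \<le> n 2" using n_ratio[of 2] by simp
      ultimately have nd: "4 * n d \<le> n 1" using n_antimono[of 3 d] 4 n21 by linarith
      have "d * ?X \<le> a * n 1 + d * n 1 + d * n d"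
        by (rule order_trans[OF X]) (intro add_right_mono add_left_mono mult_le_mono2 n21)
      then have "4 * (d * ?X) \<le> 4 * (a * n 1 + d * n 1 + d * n d)" by (rule mult_le_mono2)
      also have "\<dots> = 4 * (a * n 1 + d * n 1) + d * (4 * n d)" by (simp add: algebra_simps)
      also have "\<dots> \<le> 4 * (a * n 1 + d * n 1) + d * n 1" using nd by (intro add_left_mono mult_le_mono2)
      finally have X4: "4 * (d * ?X) \<le> 4 * (a * n 1 + d * n 1) + d * n 1" .
      \<comment> \<open>Exactly, \<open>(f + 1) * ?n0\<close> falls short of
        \<open>(f + 1) * (v - 1) * n 1\<close> by \<open>(d - 1) * n 1\<close>; dividing by
        \<open>f + 1 \<ge> 3\<close> leaves a loss of at most a third of that.\<close>
      have "N - f + (d - 1) = (f + 1) * (v - 1)" using N 4 c a by (simp add: algebra_simps)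
      moreover have "(f + 1) * ?n0 + (d - 1) * n 1 = (N - f + (d - 1)) * n 1"
        unfolding n0_eq by (rule distrib_right[symmetric])
      ultimately have n0: "(f + 1) * ?n0 + (d - 1) * n 1 = (f + 1) * (v - 1) * n 1" by (simp only:)
      have "(f + 1) * (3 * ((v - 1) * n 1)) = 3 * ((f + 1) * ?n0 + (d - 1) * n 1)"
        unfolding n0 by (simp only: mult_ac)
      also have "\<dots> = (f + 1) * (3 * ?n0) + 3 * ((d - 1) * n 1)"
        unfolding distrib_left[of 3] by (simp only: mult.left_commute)
      also have "\<dots> \<le> (f + 1) * (3 * ?n0) + (f + 1) * ((d - 1) * n 1)"
        using True by (intro add_left_mono mult_le_mono1) simp
      also have "\<dots> = (f + 1) * (3 * ?n0 + (d - 1) * n 1)" by (rule distrib_left[symmetric])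
      finally have "(f + 1) * (3 * ((v - 1) * n 1)) \<le> (f + 1) * (3 * ?n0 + (d - 1) * n 1)" .
      then have n03: "3 * ((v - 1) * n 1) \<le> 3 * ?n0 + (d - 1) * n 1" by (rule mult_left_le_imp_le) simp
      \<comment> \<open>After dividing by \<open>n 1\<close>, this reads
        \<open>12 * a + 23 * d \<le> 8 * d * d + 12 * a * d\<close>, true for
        \<open>d \<ge> 3\<close>.\<close>
      have "3 * (4 * (a * n 1 + d * n 1) + d * n 1) + 4 * d * ((d - 1) * n 1) \<le> 4 * d * (3 * ((v - 1) * n 1))"
        unfolding a c by (simp add: algebra_simps)
      also have "\<dots> \<le> 4 * d * (3 * ?n0 + (d - 1) * n 1)" by (intro mult_le_mono2 n03)
      finally have "3 * (4 * (a * n 1 + d * n 1) + d * n 1) \<le> 4 * d * (3 * ?n0)"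
        by (simp add: distrib_left)
      also have "\<dots> = 3 * (4 * (d * ?n0))" by (simp only: mult_ac)
      finally have "3 * (4 * (d * ?X)) \<le> 3 * (4 * (d * ?n0))" by (rule order_trans[OF mult_le_mono2[OF X4]])
      then have "4 * (d * ?X) \<le> 4 * (d * ?n0)" by (rule mult_left_le_imp_le) simp
      then have "d * ?X \<le> d * ?n0" by (rule mult_left_le_imp_le) simp
      then show ?thesis by (rule mult_left_le_imp_le) (use 4 in simp)
    qed
  qed
qed

text \<open>Every bin starts with one set of weight at least \<open>2\<close> as long as these last, the heaviest first.
  If there are more of them than bins, the surplus \<open>R\<close> consists of sets of weight \<open>2\<close>, which are
  paired in \<open>two_col\<close>; otherwise the \<open>e\<close> remaining bins become \<open>flat_col\<close>. Weight-\<open>1\<close> sets fill the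
  bins up to total weight \<open>d\<close>, and sets of size \<open>f + 1\<close> complete the columns.\<close>

definition big_col :: "nat \<Rightarrow> nat list" where
  "big_col w = [f + 1 - w, f + 1 + w - d] @ replicate (v - 2) (f + 1)"
definition one_col :: "nat \<Rightarrow> nat list" where
  "one_col w = (f + 1 - w) # replicate (d - w) f @ replicate (v + w - 1 - d) (f + 1)"
definition two_col :: "nat list" where
  "two_col = [f - 1, f - 1] @ replicate (d - 4) f @ replicate (v + 2 - d) (f + 1)"
definition flat_col :: "nat list" where
  "flat_col = replicate d f @ replicate (v - d) (f + 1)"

definition R :: nat where "R = M - B"
text \<open>For \<open>d = 2\<close> the sets of weight 2 are already used by
  \<open>big_col 2\<close>, hence the value 0.\<close>

definition p :: nat where "p = (if 3 \<le> d then n 2 - 2 * R else 0)"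
definition e :: nat where "e = B - M"

definition columns :: "nat list list" where
  "columns = concat (map (\<lambda>w. replicate (n w) (big_col w)) [d..<U]) @
     concat (map (\<lambda>w. replicate (n w) (one_col w)) [3..<d]) @
     replicate p (one_col 2) @ replicate R two_col @ replicate e flat_col"

text \<open>Whenever \<open>two_col\<close> occurs, \<open>d - 4\<close> is an exact difference and
  its blocks of size \<open>f - 1\<close> are nonempty.\<close>

lemma R_pos: "0 < R \<Longrightarrow> 4 \<le> d \<and> 2 \<le> f"
proof -
  assume r: "0 < R"
  then have "4 \<le> d" using M_minus_B_le(2) by (force simp: R_def)
  moreover have "0 < n 2" using r M_minus_B_le(1) by (simp add: R_def)
  ultimately show ?thesis by (auto simp: n_def split: if_splits)
qed

lemma p_eq: "3 \<le> d \<Longrightarrow> p + 2 * R = n 2"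
  using M_minus_B_le(1) by (simp add: p_def R_def)

lemma e_pos: "0 < e \<Longrightarrow> d \<le> v"
  using B_le_M d by (fastforce simp: e_def)

lemma bins_eq: "3 \<le> d \<Longrightarrow> M3 + p + R + e = B"
  using p_eq d_ge_3_split(1) by (auto simp: R_def e_def)

section \<open>Block counts of the constructed columns\<close>

lemma sum_columns:
  "(\<Sum>c\<leftarrow>columns. g c) = (\<Sum>w=d..<U. n w * g (big_col w)) + (\<Sum>w=3..<d. n w * g (one_col w)) +
     p * g (one_col 2) + R * g two_col + e * (g flat_col :: nat)"
  by (simp add: columns_def sum_list_concat_replicate sum_list_replicate)

lemma length_columns: "length columns = Big + B"
proof -
  have "length columns = (\<Sum>c\<leftarrow>columns. 1)" by (simp add: sum_list_triv)
  also have "\<dots> = Big + (M3 + p + R + e)" unfolding sum_columns by (simp add: Big_def M3_def)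
  also have "M3 + p + R + e = B"
  proof (cases "3 \<le> d")
    case False
    then have "d = 2" using d by simp
    then have "M = 0" "M3 = 0" unfolding M_def M3_def by auto
    then show ?thesis using False by (simp add: p_def R_def e_def)
  qed (rule bins_eq)
  finally show ?thesis .
qed

lemma column_valid:
  assumes "c \<in> set columns"
  shows "length c = v \<and> sum_list c = N \<and> 0 \<notin> set c"
proof -
  have f1: "1 \<le> f" by (rule f_ge_1)
  obtain u where u: "v = u + 2" using le_Suc_ex[OF v(1)] by (auto simp: add.commute)
  have onec: "length (one_col w) = v \<and> sum_list (one_col w) = N \<and> 0 \<notin> set (one_col w)"
    if w: "2 \<le> w" "w < d" "w \<le> f" for w
  proof -
    obtain x where x: "d = w + x" using w less_imp_add_positive by blast
    obtain y where y: "f = w + y" using le_Suc_ex[OF w(3)] by blast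
    obtain z where z: "v + w = d + z + 1" using le_Suc_ex[of "d + 1" "v + w"] d w by auto
    have "v = x + z + 1" using x z by simp
    moreover have "sum_list (one_col w) = y + 1 + x * f + z * (f + 1)"
      unfolding one_col_def using x y z by (simp add: sum_list_replicate)
    moreover have "N + d = (f + 1) * (x + z + 1)" using N calculation(1) by simp
    ultimately have "length (one_col w) = v" "sum_list (one_col w) = N"
      unfolding one_col_def using x y z by (auto simp: algebra_simps)
    then show ?thesis using w f1 by (auto simp: one_col_def)
  qed
  from assms consider (big) w where "d \<le> w" "w < U" "0 < n w" "c = big_col w"
    | (one1) w where "3 \<le> w" "w < d" "0 < n w" "c = one_col w"
    | (one2) "0 < p" "c = one_col 2" | (two) "0 < R" "c = two_col" | (flat) "0 < e" "c = flat_col"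
    by (auto simp: columns_def)
  then show ?thesis
  proof cases
    \<comment> \<open>The second block, of size \<open>f + 1 + w - d\<close>, compensates for the
      excess weight \<open>w - d\<close> of the first.\<close>
    case big
    then have w: "w \<le> f" using n_eq_0[of w] by (cases "f < w") auto
    have "(f + 1) * v = (f + 1) * u + 2 * (f + 1)" by (simp add: u algebra_simps)
    then show ?thesis unfolding big(4) big_col_def using big(1) w N u by (auto simp: sum_list_replicate algebra_simps)
  next
    case one1
    then have w: "w \<le> f" using n_eq_0[of w] by (cases "f < w") auto
    then show ?thesis using one1 onec[of w] by simp
  next
    case one2
    then have "3 \<le> d" "0 < n 2" by (auto simp: p_def split: if_splits)
    then have "2 < d" "2 \<le> f" using n_eq_0[of 2] by (auto simp: n_def split: if_splits)
    then show ?thesis using one2 onec[of 2] by simp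
  next
    case two
    then have d4: "4 \<le> d" and f2: "2 \<le> f" using R_pos by auto
    obtain x where x: "d = x + 4" using le_Suc_ex[OF d4] by (auto simp: add.commute)
    obtain y where y: "f = y + 2" using le_Suc_ex[OF f2] by (auto simp: add.commute)
    obtain z where z: "v + 2 = d + z" using le_Suc_ex[of d "v + 2"] d by auto
    have "v = x + z + 2" using x z by simp
    moreover have "sum_list two_col = 2 * (y + 1) + x * f + z * (f + 1)"
      unfolding two_col_def using x y z by (simp add: sum_list_replicate)
    moreover have "N + d = (f + 1) * (x + z + 2)" using N calculation(1) by simp
    ultimately have "length two_col = v" "sum_list two_col = N"
      unfolding two_col_def using x y z by (auto simp: algebra_simps)
    then show ?thesis using f2 two by (auto simp: two_col_def)
  next
    case flat
    then have dv: "d \<le> v" using e_pos by simp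
    obtain z where z: "v = d + z" using le_Suc_ex[OF dv] by auto
    show ?thesis unfolding flat(2) flat_col_def using N z f1 by (auto simp: sum_list_replicate algebra_simps)
  qed
qed

text \<open>Sizes \<open>1 \<le> i \<le> f\<close> are used as often as sets of weight
  \<open>f + 1 - i\<close> exist, except that some sets of weight 1 may remain. Size
  \<open>f + 1\<close> is the content of \<open>zero_blocks_le\<close>. A larger block is the
  partner of a small one in a \<open>big_col\<close>; the two sizes sum to at most \<open>N\<close>,
  so \<open>binomial_le_binomial\<close> applies.\<close>

lemma count_columns_le: "(\<Sum>c\<leftarrow>columns. count_list c i) \<le> N choose i"
proof -
  let ?S = "\<Sum>c\<leftarrow>columns. count_list c i"
  have big: "count_list (big_col w) i = of_bool (f + 1 - w = i) + of_bool (f + 1 + w - d = i) + (v - 2) * of_bool (f + 1 = i)" for w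
    by (auto simp: big_col_def count_list_replicate)
  have one: "count_list (one_col w) i = of_bool (f + 1 - w = i) + (d - w) * of_bool (f = i) + (v + w - 1 - d) * of_bool (f + 1 = i)" for w
    by (auto simp: one_col_def count_list_replicate)
  have two: "count_list two_col i = 2 * of_bool (f - 1 = i) + (d - 4) * of_bool (f = i) + (v + 2 - d) * of_bool (f + 1 = i)"
    by (auto simp: two_col_def count_list_replicate)
  have flat: "count_list flat_col i = d * of_bool (f = i) + (v - d) * of_bool (f + 1 = i)"
    by (auto simp: flat_col_def count_list_replicate)
  define Z1 where "Z1 = (\<Sum>w=3..<d. n w * (d - w)) + p * (d - 2) + R * (d - 4) + e * d"
  define Z where "Z = (\<Sum>w=3..<d. n w * (v + w - 1 - d)) + p * (v + 1 - d) + R * (v + 2 - d) + e * (v - d)"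
  have S: "?S = (\<Sum>w=d..<U. n w * of_bool (f + 1 - w = i)) + (\<Sum>w=d..<U. n w * of_bool (f + 1 + w - d = i))
      + (\<Sum>w=3..<d. n w * of_bool (f + 1 - w = i)) + p * of_bool (f - 1 = i) + 2 * R * of_bool (f - 1 = i)
      + Z1 * of_bool (f = i) + (Z + (v - 2) * Big) * of_bool (f + 1 = i)"
    unfolding sum_columns big one two flat Z_def Z1_def Big_def
    by (simp add: sum.distrib distrib_left distrib_right sum_distrib_right sum_distrib_left mult_ac)
  \<comment> \<open>Every bin has total weight exactly \<open>d\<close>.\<close>
  have Z2: "Z1 + W2 = d * B"
  proof (cases "3 \<le> d")
    case True
    have "(\<Sum>w=3..<d. n w * (d - w)) + (\<Sum>w=3..<d. w * n w) = (\<Sum>w=3..<d. d * n w)"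
      unfolding sum.distrib[symmetric] by (intro sum.cong) (auto simp: algebra_simps diff_mult_distrib2)
    then have 1: "(\<Sum>w=3..<d. n w * (d - w)) + (\<Sum>w=3..<d. w * n w) = d * M3"
      by (simp add: M3_def sum_distrib_left)
    have 2: "p * (d - 2) + 2 * p = d * p" using True by (simp add: algebra_simps diff_mult_distrib2)
    have 3: "R * (d - 4) + 4 * R = d * R"
      using R_pos by (cases "R = 0") (auto simp: algebra_simps diff_mult_distrib2)
    have "d * B = d * M3 + d * p + d * R + e * d"
      unfolding bins_eq[OF True, symmetric] by (simp add: algebra_simps)
    moreover have "a + pp + rr + ee + (2 * (p + 2 * r) + b) = t"
      if "t = m + dp + dr + ee" "a + b = m" "pp + 2 * p = dp" "rr + 4 * r = dr"
      for a b pp p rr r ee m dp dr t :: nat using that by simp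
    ultimately show ?thesis unfolding Z1_def d_ge_3_split(2)[OF True] p_eq[OF True, symmetric]
      using 1 2 3 by blast
  next
    case False
    then have "d = 2" using d by simp
    then have "M = 0" "W2 = 0" "(\<Sum>w=3..<d. n w * (d - w)) = 0" unfolding M_def W2_def by auto
    then show ?thesis using False by (simp add: Z1_def p_def R_def e_def)
  qed
  \<comment> \<open>Every bin has \<open>v\<close> blocks, sorted here by weight 0, weight 1 and
    weight at least 2.\<close>
  have Z1: "Z + Z1 + M = v * B"
  proof (cases "3 \<le> d")
    case True
    have "(\<Sum>w=3..<d. n w * (v + w - 1 - d)) + (\<Sum>w=3..<d. n w * (d - w)) + M3
        = (\<Sum>w=3..<d. n w * (v + w - 1 - d) + n w * (d - w) + n w)"
      by (simp add: M3_def sum.distrib)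
    also have "\<dots> = (\<Sum>w=3..<d. v * n w)"
    proof (intro sum.cong refl)
      fix w assume w: "w \<in> {3..<d}"
      have "n w * (v + w - 1 - d) + n w * (d - w) + n w = n w * ((v + w - 1 - d) + (d - w) + 1)"
        by (simp only: distrib_left mult_1_right)
      also have "(v + w - 1 - d) + (d - w) + 1 = v" using w d by auto
      finally show "n w * (v + w - 1 - d) + n w * (d - w) + n w = v * n w" by (simp add: mult.commute)
    qed
    finally have 1: "(\<Sum>w=3..<d. n w * (v + w - 1 - d)) + (\<Sum>w=3..<d. n w * (d - w)) + M3 = v * M3"
      by (simp add: M3_def sum_distrib_left)
    have "p * (v + 1 - d) + p * (d - 2) + p = p * ((v + 1 - d) + (d - 2) + 1)"
      by (simp only: distrib_left mult_1_right)
    also have "(v + 1 - d) + (d - 2) + 1 = v" using True d by auto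
    finally have 2: "p * (v + 1 - d) + p * (d - 2) + p = v * p" by (simp add: mult.commute)
    have 3: "R * (v + 2 - d) + R * (d - 4) + 2 * R = v * R"
    proof (cases "R = 0")
      case False
      have "R * (v + 2 - d) + R * (d - 4) + 2 * R = R * ((v + 2 - d) + (d - 4) + 2)"
        by (simp only: distrib_left mult.commute)
      also have "(v + 2 - d) + (d - 4) + 2 = v" using R_pos False d by auto
      finally show ?thesis by (simp add: mult.commute)
    qed simp
    have 4: "e * (v - d) + e * d = v * e"
      using e_pos by (cases "e = 0") (auto simp flip: distrib_left)
    have "v * B = v * M3 + v * p + v * R + v * e"
      unfolding bins_eq[OF True, symmetric] by (simp add: algebra_simps)
    moreover have "M = p + 2 * R + M3" using d_ge_3_split(1)[OF True] p_eq[OF True] by simp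
    moreover have "(a + b + c + d) + (a' + b' + c' + d') + m = t"
      if "t = va + vb + vc + vd" "m = p + 2 * r + m3" "a + a' + m3 = va" "b + b' + p = vb"
        "c + c' + 2 * r = vc" "d + d' = vd"
      for a b c d a' b' c' d' va vb vc vd p r m3 m t :: nat using that by simp
    ultimately show ?thesis unfolding Z1_def Z_def using 1 2 3 4 by blast
  next
    case False
    then have d2: "d = 2" using d by simp
    then have "M = 0" "(\<Sum>w=3..<d. n w * (d - w)) = 0" "(\<Sum>w=3..<d. n w * (v + w - 1 - d)) = 0"
      unfolding M_def by auto
    then have "Z = B * (v - d)" "Z1 = B * d" using False by (auto simp: Z_def Z1_def p_def R_def e_def)
    then have "Z + Z1 = B * ((v - d) + d)" by (simp only: distrib_left)
    also have "(v - d) + d = v" using d2 v by simp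
    finally show ?thesis using \<open>M = 0\<close> by (simp add: mult.commute)
  qed
  have delta: "(\<Sum>w=a..<b. n w * of_bool (f + 1 - w = i)) = (if a \<le> f + 1 - i \<and> f + 1 - i < b then n (f + 1 - i) else 0)"
    if "1 \<le> i" "i \<le> f" for a b
  proof -
    have "(\<Sum>w=a..<b. n w * of_bool (f + 1 - w = i)) = (\<Sum>w=a..<b. if w = f + 1 - i then n w else 0)"
      using that by (intro sum.cong) auto
    then show ?thesis by (auto simp: sum.delta)
  qed
  have zero: "(\<Sum>w=a..<b. n w * of_bool (f + 1 - w = i)) = 0" if "f < i" "1 \<le> a" for a b
    using that by (intro sum.neutral) auto
  \<comment> \<open>For \<open>w = d\<close> the compensating block has size \<open>f + 1\<close>;
    this produces the term \<open>n d\<close> in \<open>zero_blocks_le\<close>.\<close>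
  have delta2: "(\<Sum>w=d..<U. n w * of_bool (f + 1 + w - d = i)) = n (i + d - (f + 1))" if "f < i"
  proof -
    have "(\<Sum>w=d..<U. n w * of_bool (f + 1 + w - d = i)) = (\<Sum>w=d..<U. if w = i + d - (f + 1) then n w else 0)"
      using that by (intro sum.cong) auto
    then show ?thesis using that by (auto simp: sum.delta U_def n_eq_0)
  qed
  have zero2: "(\<Sum>w=d..<U. n w * of_bool (f + 1 + w - d = i)) = 0" if "i \<le> f"
    using that by (intro sum.neutral) auto
  have ne: "f - 1 \<noteq> i" if "f < i" using that by simp
  consider "i = 0" | "1 \<le> i" "i \<le> f" | "i = f + 1" | "f + 1 < i" by linarith
  then show ?thesis
  proof cases
    case 1
    have "?S = (\<Sum>c\<leftarrow>columns. 0)"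
      using column_valid 1 by (intro arg_cong[of _ _ sum_list] map_cong) (auto simp: count_list_0_iff)
    also have "\<dots> = 0" by (simp add: sum_list_0)
    finally have "?S = 0" .
    then show ?thesis by (rule ord_eq_le_trans) simp
  next
    case 2
    define w where "w = f + 1 - i"
    have w: "1 \<le> w" "w \<le> f" "i = f + 1 - w" using 2 by (auto simp: w_def)
    have Ni: "N choose i = n w" using w by (simp add: n_def)
    have wU: "w < U" using w by (simp add: U_def)
    note S' = S[unfolded delta[OF 2] zero2[OF 2(2)], folded w_def]
    have Z1le: "Z1 \<le> n 1" using Z2 B_le by linarith
    consider "d \<le> w" | "w < d" "3 \<le> w" | "w = 2" "w < d" | "w = 1" using w by linarith
    then show ?thesis
    proof cases
      case 1
      have "d = 2" if "f - 1 = i" using 1 w d that by linarith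
      then have "p = 0 \<and> R = 0" if "f - 1 = i" unfolding p_def using that R_pos by (cases "R = 0") auto
      then show ?thesis unfolding S' Ni using 1 w d wU by auto
    next
      case 2 then show ?thesis unfolding S' Ni using w d by auto
    next
      case 3 then show ?thesis unfolding S' Ni using w p_eq by auto
    next
      case 4 then show ?thesis unfolding S' Ni using w d Z1le f_ge_1 by auto
    qed
  next
    case 3
    have "?S = n d + Z + (v - 2) * Big"
      unfolding S using 3 d zero[of d U] zero[of 3 d] delta2 ne by simp
    then show ?thesis using zero_blocks_le[OF Z1 Z2] 3 by simp
  next
    case 4
    have eq: "?S = n (i + d - (f + 1))"
      unfolding S using 4 d zero[of d U] zero[of 3 d] delta2 ne by simp
    show ?thesis
    proof (cases "i + d - (f + 1) \<le> f")
      case True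
      define j where "j = f + 1 - (i + d - (f + 1))"
      have j: "j + i + d = 2 * (f + 1)" using True 4 by (simp add: j_def)
      have "2 * (f + 1) \<le> v * (f + 1)" using v by (intro mult_le_mono1)
      then have "j + i \<le> N" using j N by (simp add: algebra_simps)
      then have "N choose j \<le> N choose i" using j 4 d by (intro binomial_le_binomial) auto
      then show ?thesis unfolding eq using 4 d True by (simp add: n_def j_def)
    next
      case False
      then show ?thesis unfolding eq by (simp add: n_eq_0)
    qed
  qed
qed

section \<open>The value of \<open>LAK_bar1_1\<close> and its closed form\<close>

lemma weights_sum: "n 1 + W2 = (\<Sum>w=1..<d. w * n w)"
  using d by (simp add: W2_def sum.atLeast_Suc_lessThan numeral_2_eq_2)

lemma sum_weights_eq: "(\<Sum>i=1..f. min d (f + 1 - i) * (N choose i)) = n 1 + W2 + d * Big"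
proof -
  have "(\<Sum>i=1..f. min d (f + 1 - i) * (N choose i)) = (\<Sum>w=1..f. min d (f + 1 - (f + 1 - w)) * (N choose (f + 1 - w)))"
    by (subst sum.atLeastAtMost_rev) simp
  also have "\<dots> = (\<Sum>w=1..f. min d w * n w)" by (intro sum.cong) (auto simp: n_def)
  also have "\<dots> = (\<Sum>w=1..<U. min d w * n w)"
    by (intro sum.mono_neutral_left) (auto simp: U_def n_eq_0)
  also have "\<dots> = (\<Sum>w=1..<d. min d w * n w) + (\<Sum>w=d..<U. min d w * n w)"
    using d by (subst sum.atLeastLessThan_concat) (auto simp: U_def)
  also have "(\<Sum>w=d..<U. min d w * n w) = d * Big"
    unfolding Big_def sum_distrib_left by (intro sum.cong) auto
  also have "(\<Sum>w=1..<d. min d w * n w) = (\<Sum>w=1..<d. w * n w)" by (intro sum.cong) auto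
  also have "\<dots> = n 1 + W2" by (rule weights_sum[symmetric])
  finally show ?thesis .
qed

text \<open>The upper bound is the floor of \<open>(n 1 + W2 + d * Big) / d\<close>. Since
  \<open>d * Big\<close> is divisible by \<open>d\<close>, it equals the number of constructed
  columns.\<close>

theorem LAK_eq: "LAK_bar1_1 N v = B + Big"
  unfolding LAK_bar1_1_def
proof (rule Max_eqI)
  show "finite (locating_sizes N v)" using v by (intro finite_locating_sizes) simp
  show "B + Big \<in> locating_sizes N v"
    using locating_sizes_of_block_sizes[OF column_valid count_columns_le] by (simp add: length_columns add.commute)
  fix k assume "k \<in> locating_sizes N v"
  from locating_sizes_upper_bound[OF this N] have "k * d \<le> n 1 + W2 + d * Big"
    unfolding sum_weights_eq by (simp add: mult.commute)
  then have "k * d div d \<le> (n 1 + W2 + d * Big) div d" by (rule div_le_mono)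
  then have "k \<le> (n 1 + W2 + d * Big) div d" using d(1) by (simp del: div_mult_self2)
  also have "\<dots> = B + Big" using d by (subst div_mult_self2) (auto simp: B_def)
  finally show "k \<le> B + Big" .
qed

lemma binom_int_eq_n:
  assumes "1 \<le> w" "w \<le> f"
  shows "binom_int N (int f + 1 - int w) = int (n w)"
proof -
  have "nat (int f + 1 - int w) = f + 1 - w" using assms by linarith
  then show ?thesis using assms by (simp add: binom_int_def n_def)
qed

text \<open>Substitution \<open>w = f + 1 - i\<close>; the assumptions keep \<open>i\<close> between
  1 and \<open>f\<close>, so the integer binomials agree with \<open>n\<close>.\<close>

lemma sum_binom_int_eq:
  assumes "1 \<le> a" "b \<le> f + 1"
  shows "(\<Sum>i = int f + 2 - int b..int f + 1 - int a. g (int f + 1 - i) * binom_int N i) = (\<Sum>w=a..<b. g (int w) * int (n w))"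
proof (rule sum.reindex_bij_witness[of _ "\<lambda>w. int f + 1 - int w" "\<lambda>i. nat (int f + 1 - i)"])
  fix i assume i: "i \<in> {int f + 2 - int b..int f + 1 - int a}"
  then have "binom_int N (int f + 1 - int (nat (int f + 1 - i))) = int (n (nat (int f + 1 - i)))"
    using assms by (intro binom_int_eq_n) auto
  then show "g (int (nat (int f + 1 - i))) * int (n (nat (int f + 1 - i))) = g (int f + 1 - i) * binom_int N i"
    using i assms by simp
qed (use assms in auto)

lemma weights_sum_cut: "f < d \<Longrightarrow> n 1 + W2 = (\<Sum>w=1..<f + 1. w * n w)"
  unfolding weights_sum by (intro sum.mono_neutral_right) (auto simp: n_eq_0)

lemma Big_cut: "d \<le> f + 1 \<Longrightarrow> Big = (\<Sum>w=d..<f + 1. n w)"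
  unfolding Big_def by (intro sum.mono_neutral_right) (auto simp: n_eq_0 U_def)

lemma Big_eq_0: "f < d \<Longrightarrow> Big = 0"
  unfolding Big_def by (intro sum.neutral) (auto simp: n_eq_0)

end

text \<open>Adding \<open>c < d\<close> raises the quotient by at most 1, and leaves it unchanged
  exactly when the new residue is at least \<open>c\<close>. With \<open>c = f + 1\<close>, the
  weight of the empty set, this yields the case distinction of the formula.\<close>

lemma div_add_small_eq:
  fixes W c d :: int
  assumes "0 < c" "c < d"
  shows "W div d = (if \<exists>x\<in>{c..d - 1}. [W + c = x] (mod d) then (W + c) div d else (W + c) div d - 1)"
proof -
  define m where "m = (W + c) mod d"
  have m: "0 \<le> m" "m < d" using assms by (auto simp: m_def)
  have W: "W = d * ((W + c) div d) + m - c" by (simp add: m_def)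
  have iff: "(\<exists>x\<in>{c..d - 1}. [W + c = x] (mod d)) \<longleftrightarrow> c \<le> m"
  proof
    assume "\<exists>x\<in>{c..d - 1}. [W + c = x] (mod d)"
    then obtain x where x: "c \<le> x" "x < d" "(W + c) mod d = x mod d" by (auto simp: cong_def)
    then have "m = x" using assms by (simp add: m_def)
    then show "c \<le> m" using x by simp
  next
    assume "c \<le> m"
    then show "\<exists>x\<in>{c..d - 1}. [W + c = x] (mod d)"
      using m by (intro bexI[of _ m]) (auto simp: cong_def m_def)
  qed
  show ?thesis
  proof (cases "c \<le> m")
    case True
    have "W div d = (W + c) div d"
      by (rule int_div_pos_eq[where r = "m - c"]) (use W True m assms in auto)
    then show ?thesis using iff True by simp
  next
    case False
    have "W div d = (W + c) div d - 1"
      by (rule int_div_pos_eq[where r = "m - c + d"]) (use W False m assms in \<open>auto simp: algebra_simps\<close>)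
    then show ?thesis using iff False by simp
  qed
qed

theorem theorem6p1:
  fixes N v :: nat and f d \<Lambda> :: int
  assumes "2 \<le> v" and "v \<le> N"
    and "f = \<lfloor>(real N + 1) / real v\<rfloor>"
    and "d = (f + 1) * int v - int N"
    and "\<Lambda> = \<lfloor>1 / real_of_int d *
               real_of_int (\<Sum>i = f - d + 2..f. (f + 1 - i) * binom_int N i)\<rfloor>
             + (\<Sum>i = 0..f - d + 1. binom_int N i)"
  shows "int (LAK_bar1_1 N v) =
    (if d \<ge> f + 2 \<and>
        (\<exists>x\<in>{f + 1..d - 1}. [(\<Sum>i = 0..f. (f + 1 - i) * binom_int N i) = x] (mod d))
     then \<Lambda> else \<Lambda> - 1)"
proof -
  define F where "F = (N + 1) div v"
  define r where "r = (N + 1) mod v"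
  define D where "D = v + 1 - r"
  have r: "r < v" "N + 1 = F * v + r" using assms(1) by (auto simp: r_def F_def)
  have f: "f = int F"
    using floor_divide_of_nat_eq[of "N + 1" v, where 'a = real] assms(3) by (simp add: F_def add.commute)
  have ND: "N + D = (F + 1) * v" using r by (simp add: D_def)
  have dD: "d = int D"
  proof -
    have "int N + int D = (int F + 1) * int v"
      using arg_cong[OF ND, of int] by (simp add: algebra_simps)
    then show ?thesis unfolding assms(4) f by linarith
  qed
  interpret block_weights N v F D
    using assms(1,2) ND r by unfold_locales (auto simp: D_def)
  have floor: "\<lfloor>1 / real_of_int d * real_of_int s\<rfloor> = s div d" for s
    using floor_divide_of_int_eq[of s d, where 'a = real] by simp
  define S where "S = (\<Sum>i = f - d + 2..f. (f + 1 - i) * binom_int N i)"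
  have LAK: "int (LAK_bar1_1 N v) = int (n 1 + W2) div d + int Big"
    unfolding LAK_eq B_def dD by (simp add: zdiv_int)
  have head: "(\<Sum>i = 0..b. g i * binom_int N i) = g 0 + (\<Sum>i = 1..b. g i * binom_int N i)" if "0 \<le> b" for g :: "int \<Rightarrow> int" and b
  proof -
    have "{0..b} = insert 0 {1..b}" using that by auto
    then show ?thesis by (simp add: binom_int_def)
  qed
  show ?thesis
  proof (cases "D \<le> F + 1")
    \<comment> \<open>The empty set appears as \<open>i = 0\<close> in the second sum of
      \<open>\<Lambda>\<close> and adds exactly 1, the amount subtracted in the formula.\<close>
    case True
    have "S = int (n 1 + W2)"
      using sum_binom_int_eq[of 1 D "\<lambda>x. x"] True unfolding S_def f dD weights_sum
      by (simp add: algebra_simps)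
    moreover have "(\<Sum>i = 1..f - d + 1. 1 * binom_int N i) = int Big"
      using sum_binom_int_eq[of D "F + 1" "\<lambda>_. 1"] True d(1) unfolding f dD Big_cut[OF True]
      by (simp add: algebra_simps)
    ultimately have "\<Lambda> = int (n 1 + W2) div d + 1 + int Big"
      unfolding assms(5) floor using head[of "f - d + 1" "\<lambda>_. 1"] True f dD by (simp add: S_def)
    then show ?thesis using LAK True f dD by simp
  next
    \<comment> \<open>Now the second sum of \<open>\<Lambda>\<close> is empty, and the empty set
      enters the first one with weight \<open>f + 1 < d\<close>; indices \<open>i < 0\<close>
      contribute nothing.\<close>
    case False
    have "(\<Sum>i = 1..f. (f + 1 - i) * binom_int N i) = int (n 1 + W2)"
      using sum_binom_int_eq[of 1 "F + 1" "\<lambda>x. x"] False weights_sum_cut unfolding f by simp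
    then have T: "(\<Sum>i = 0..f. (f + 1 - i) * binom_int N i) = int (n 1 + W2) + (f + 1)"
      using head[of f "\<lambda>i. f + 1 - i"] f by simp
    have "S = (\<Sum>i = 0..f. (f + 1 - i) * binom_int N i)"
      unfolding S_def using False f dD by (intro sum.mono_neutral_right) (auto simp: binom_int_def)
    then have "\<Lambda> = (int (n 1 + W2) + (f + 1)) div d"
      unfolding assms(5) floor using T False f dD by (simp add: S_def)
    moreover have "int (LAK_bar1_1 N v) = int (n 1 + W2) div d" using LAK Big_eq_0 False by simp
    ultimately show ?thesis
      unfolding T using div_add_small_eq[of "f + 1" d "int (n 1 + W2)"] False f dD by simp
  qed
qed

end
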